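(* Let $G=(V,E)$ be a directed acyclic graph that is an inforest, and let $\Sigma$ be the set of permutations of $V$ feasible for the OR-precedence constraints given by $G$. Let $f,g:2^V\to\mathbb{R}$ be non-decreasing with respect to inclusion with $f(\emptyset)=g(\emptyset)=0$, given by value oracles, with $f$ modular and $g$ submodular. Then there is a polynomial time $4$-approximation algorithm for the problem of minimizing $\sum_{j=1}^n f(S^\sigma_j)(g(S^\sigma_j)-g(S^\sigma_{j-1}))$ over $\sigma\in\Sigma$.
   Context: $n=|V|$; for a permutation $\sigma$, $S^\sigma_j$ is the set of its first $j$ elements ($S^\sigma_0=\emptyset$). For $v\in V$, $\mathcal{P}(v)=\{u:(u,v)\in E\}$. A permutation is feasible for the OR-precedence constraints if every $v$ with $\mathcal{P}(v)\ne\emptyset$ appears after at least one element of $\mathcal{P}(v)$. An intree is a (weakly) connected DAG in which every vertex has at most one successor (out-degree at most one); an inforest is a DAG whose connected components are intrees. $f$ is modular if $f(S)=\sum_{v\in S}c_v$; $g$ is submodular if $g(S\cup T)+g(S\cap T)\le g(S)+g(T)$. A $4$-approximation outputs a feasible permutation with objective at most $4$ times the optimum. *)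

theory Defs
  imports
    Complex_Main
    "HOL-Computational_Algebra.Polynomial"
    "HOL-Combinatorics.Multiset_Permutations"
    "Graph_Theory.Digraph_Component"
begin

section \<open>Inforests\<close>

definition dag :: "('a, 'b) pre_digraph \<Rightarrow> bool" where
  "dag G \<longleftrightarrow> digraph G \<and> acyclic (arcs_ends G)"

text \<open>
  \<^const>\<open>Digraph_Component.connected\<close> is connectedness of the underlying undirected graph,
  i.e. weak connectedness.
\<close>

definition intree :: "('a, 'b) pre_digraph \<Rightarrow> bool" where
  "intree G \<longleftrightarrow> dag G \<and> Digraph_Component.connected G \<and> (\<forall>v\<in>verts G. out_degree G v \<le> 1)"

definition inforest :: "('a, 'b) pre_digraph \<Rightarrow> bool" where
  "inforest G \<longleftrightarrow>
     dag G \<and> (\<forall>H. pre_digraph.max_subgraph G Digraph_Component.connected H \<longrightarrow> intree H)"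


section \<open>Min-sum ordering with OR-precedence constraints\<close>

definition preds :: "('a, 'b) pre_digraph \<Rightarrow> 'a \<Rightarrow> 'a set" where
  "preds G v = {u. (u, v) \<in> arcs_ends G}"

text \<open>
  A permutation of the vertex set is the list of its elements in order, so that
  \<open>S\<^sup>\<sigma>\<^sub>j\<close> is \<open>set (take j \<sigma>)\<close> and the element following it is \<open>\<sigma> ! j\<close>.
\<close>

definition or_feasible :: "('a, 'b) pre_digraph \<Rightarrow> 'a list set" where
  "or_feasible G = {\<sigma> \<in> permutations_of_set (verts G).
     \<forall>j < card (verts G). preds G (\<sigma> ! j) \<noteq> {} \<longrightarrow> preds G (\<sigma> ! j) \<inter> set (take j \<sigma>) \<noteq> {}}"

definition ordering_cost :: "('a set \<Rightarrow> real) \<Rightarrow> ('a set \<Rightarrow> real) \<Rightarrow> 'a list \<Rightarrow> real" where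
  "ordering_cost f g \<sigma> =
     (\<Sum>j = 1..length \<sigma>. f (set (take j \<sigma>)) * (g (set (take j \<sigma>)) - g (set (take (j - 1) \<sigma>))))"

definition modular_on :: "'a set \<Rightarrow> ('a set \<Rightarrow> real) \<Rightarrow> bool" where
  "modular_on V f \<longleftrightarrow> (\<exists>c :: 'a \<Rightarrow> real. \<forall>S \<subseteq> V. f S = (\<Sum>v\<in>S. c v))"

definition submodular_on :: "'a set \<Rightarrow> ('a set \<Rightarrow> real) \<Rightarrow> bool" where
  "submodular_on V g \<longleftrightarrow> (\<forall>S \<subseteq> V. \<forall>T \<subseteq> V. g (S \<union> T) + g (S \<inter> T) \<le> g S + g T)"


section \<open>Algorithms with value oracles\<close>

text \<open>
  The machine is a random access machine with value oracles, programmed in a while language.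
  It has unboundedly many memory cells for natural numbers and, separately, for real numbers;
  both memories are organised as arrays, and a scalar variable is cell 0 of an array.

  Every command takes one unit of time, since expressions have constant size and make a constant
  number of oracle calls. To make unit cost a realistic measure, arithmetic on stored numbers is
  restricted to addition and subtraction, products of reals only occur in comparisons, and all
  constants are integers. Hence a polynomial number of steps cannot produce numbers of
  superpolynomial length (e.g. by repeated squaring), and if all oracle values are
  rational then the bit complexity is polynomial as well.

  The vertices are numbered \<open>0, \<dots>, num_vertices - 1\<close>. Arcs are read from an adjacency matrix. An
  oracle call queries the set of all vertices marked by a nonzero entry of a given array.
\<close>

record machine_input =
  num_vertices :: nat
  adj :: "nat \<Rightarrow> nat \<Rightarrow> bool"
  f_oracle :: "nat set \<Rightarrow> real"
  g_oracle :: "nat set \<Rightarrow> real"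

record state =
  nat_mem :: "string \<Rightarrow> nat \<Rightarrow> nat"
  real_mem :: "string \<Rightarrow> nat \<Rightarrow> real"

datatype nexp =
    NConst nat
  | NumVertices
  | NCell string nexp
  | NPlus nexp nexp
  | NMinus nexp nexp

datatype rexp =
    RConst int
  | RCell string nexp
  | RPlus rexp rexp
  | RMinus rexp rexp
  | QueryF string
  | QueryG string

datatype bexp =
    NLess nexp nexp
  | HasArc nexp nexp
  | ProdLess rexp rexp rexp rexp
  | BNot bexp
  | BAnd bexp bexp

datatype com =
    Skip
  | NAssign string nexp nexp
  | RAssign string nexp rexp
  | Seq com com
  | Cond bexp com com
  | While bexp com

definition marked :: "machine_input \<Rightarrow> state \<Rightarrow> string \<Rightarrow> nat set" where
  "marked I s x = {i. i < num_vertices I \<and> nat_mem s x i \<noteq> 0}"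

primrec nval :: "machine_input \<Rightarrow> nexp \<Rightarrow> state \<Rightarrow> nat" where
  "nval I (NConst k) s = k"
| "nval I NumVertices s = num_vertices I"
| "nval I (NCell x a) s = nat_mem s x (nval I a s)"
| "nval I (NPlus a b) s = nval I a s + nval I b s"
| "nval I (NMinus a b) s = nval I a s - nval I b s"

primrec rval :: "machine_input \<Rightarrow> rexp \<Rightarrow> state \<Rightarrow> real" where
  "rval I (RConst k) s = of_int k"
| "rval I (RCell x a) s = real_mem s x (nval I a s)"
| "rval I (RPlus a b) s = rval I a s + rval I b s"
| "rval I (RMinus a b) s = rval I a s - rval I b s"
| "rval I (QueryF x) s = f_oracle I (marked I s x)"
| "rval I (QueryG x) s = g_oracle I (marked I s x)"

primrec bval :: "machine_input \<Rightarrow> bexp \<Rightarrow> state \<Rightarrow> bool" where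
  "bval I (NLess a b) s \<longleftrightarrow> nval I a s < nval I b s"
| "bval I (HasArc a b) s \<longleftrightarrow> adj I (nval I a s) (nval I b s)"
| "bval I (ProdLess a b c d) s \<longleftrightarrow> rval I a s * rval I b s < rval I c s * rval I d s"
| "bval I (BNot b) s \<longleftrightarrow> \<not> bval I b s"
| "bval I (BAnd b c) s \<longleftrightarrow> bval I b s \<and> bval I c s"

text \<open>
  \<open>exec I c s t s'\<close> means that on input \<open>I\<close> the program \<open>c\<close>, started in state \<open>s\<close>, halts in
  state \<open>s'\<close> after exactly \<open>t\<close> steps.
\<close>

inductive exec :: "machine_input \<Rightarrow> com \<Rightarrow> state \<Rightarrow> nat \<Rightarrow> state \<Rightarrow> bool" for I where
  Skip: "exec I Skip s 1 s"
| NAssign: "exec I (NAssign x a e) s 1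
    (s\<lparr>nat_mem := (nat_mem s)(x := (nat_mem s x)(nval I a s := nval I e s))\<rparr>)"
| RAssign: "exec I (RAssign x a e) s 1
    (s\<lparr>real_mem := (real_mem s)(x := (real_mem s x)(nval I a s := rval I e s))\<rparr>)"
| Seq: "exec I c1 s1 t1 s2 \<Longrightarrow> exec I c2 s2 t2 s3 \<Longrightarrow> exec I (Seq c1 c2) s1 (t1 + t2) s3"
| CondTrue: "bval I b s \<Longrightarrow> exec I c1 s t s' \<Longrightarrow> exec I (Cond b c1 c2) s (t + 1) s'"
| CondFalse: "\<not> bval I b s \<Longrightarrow> exec I c2 s t s' \<Longrightarrow> exec I (Cond b c1 c2) s (t + 1) s'"
| WhileFalse: "\<not> bval I b s \<Longrightarrow> exec I (While b c) s 1 s"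
| WhileTrue: "bval I b s1 \<Longrightarrow> exec I c s1 t1 s2 \<Longrightarrow> exec I (While b c) s2 t2 s3 \<Longrightarrow>
    exec I (While b c) s1 (t1 + t2 + 1) s3"

inductive_cases SkipE: "exec I Skip s t s'"
inductive_cases NAssignE: "exec I (NAssign x a e) s t s'"
inductive_cases RAssignE: "exec I (RAssign x a e) s t s'"
inductive_cases SeqE: "exec I (Seq c1 c2) s t s'"
inductive_cases CondE: "exec I (Cond b c1 c2) s t s'"
inductive_cases WhileE: "exec I (While b c) s t s'"

lemma exec_deterministic:
  assumes "exec I c s t s'" and "exec I c s u s''"
  shows "t = u \<and> s' = s''"
  using assms
proof (induction arbitrary: u s'' rule: exec.induct)
  case (Seq c1 s1 t1 s2 c2 t2 s3)
  from Seq.prems obtain u1 u2 s where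
    "exec I c1 s1 u1 s" "exec I c2 s u2 s''" "u = u1 + u2"
    by (rule SeqE)
  with Seq.IH show ?case by metis
next
  case (CondTrue b s c1 t s' c2)
  from CondTrue.prems CondTrue.hyps obtain u' where "exec I c1 s u' s''" "u = u' + 1"
    by (auto elim: CondE)
  with CondTrue.IH show ?case by metis
next
  case (CondFalse b s c2 t s' c1)
  from CondFalse.prems CondFalse.hyps obtain u' where "exec I c2 s u' s''" "u = u' + 1"
    by (auto elim: CondE)
  with CondFalse.IH show ?case by metis
next
  case (WhileFalse b s c)
  from WhileFalse.prems WhileFalse.hyps show ?case by (auto elim: WhileE)
next
  case (WhileTrue b s1 c t1 s2 t2 s3)
  from WhileTrue.prems WhileTrue.hyps obtain u1 u2 s where
    "exec I c s1 u1 s" "exec I (While b c) s u2 s''" "u = u1 + u2 + 1"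
    by (cases rule: exec.cases) auto
  with WhileTrue.IH show ?case by metis
qed (auto elim: SkipE NAssignE RAssignE)

definition init :: state where
  "init = \<lparr>nat_mem = \<lambda>_ _. 0, real_mem = \<lambda>_ _. 0\<rparr>"

text \<open>
  The list \<open>vs\<close> is the numbering of the vertices under which the instance is presented to the
  machine: vertex number \<open>i\<close> is \<open>vs ! i\<close>.
\<close>

definition present ::
  "'a list \<Rightarrow> ('a, 'b) pre_digraph \<Rightarrow> ('a set \<Rightarrow> real) \<Rightarrow> ('a set \<Rightarrow> real) \<Rightarrow> machine_input" where
  "present vs G f g =
    \<lparr>num_vertices = length vs,
     adj = \<lambda>i j. i < length vs \<and> j < length vs \<and> (vs ! i, vs ! j) \<in> arcs_ends G,
     f_oracle = \<lambda>A. f ((!) vs ` A),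
     g_oracle = \<lambda>A. g ((!) vs ` A)\<rparr>"

text \<open>The output is the sequence of vertex numbers left in the array \<open>out\<close>.\<close>

definition outputs :: "'a list \<Rightarrow> state \<Rightarrow> 'a list \<Rightarrow> bool" where
  "outputs vs s \<sigma> \<longleftrightarrow> length \<sigma> = length vs \<and>
     (\<forall>j < length vs. nat_mem s ''out'' j < length vs \<and> \<sigma> ! j = vs ! nat_mem s ''out'' j)"

text \<open>
  \<open>c\<close> halts within \<open>T\<close> steps on the given instance, however its vertices are numbered, and its
  output is a feasible permutation with cost at most \<open>\<alpha>\<close> times the optimum.
\<close>

definition approximates_within ::
  "real \<Rightarrow> com \<Rightarrow> nat \<Rightarrow> ('a, 'b) pre_digraph \<Rightarrow> ('a set \<Rightarrow> real) \<Rightarrow> ('a set \<Rightarrow> real) \<Rightarrow> bool" where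
  "approximates_within \<alpha> c T G f g \<longleftrightarrow>
     (\<forall>vs \<in> permutations_of_set (verts G). \<exists>t s \<sigma>.
        exec (present vs G f g) c init t s \<and> t \<le> T \<and> outputs vs s \<sigma> \<and>
        \<sigma> \<in> or_feasible G \<and>
        ordering_cost f g \<sigma> \<le> \<alpha> * Min (ordering_cost f g ` or_feasible G))"

end

theory Submission
  imports Defs
begin

text \<open>
  The algorithm repeatedly appends to the current order \<open>\<sigma>\<close>, with element set \<open>A\<close>, a directed path
  \<open>P\<close> of unused vertices that is feasible after \<open>\<sigma>\<close> and maximises the density
  \<open>(g (A \<union> P) - g A) / (f (A \<union> P) - f A)\<close>. There are only quadratically many such paths, since in an
  inforest a path is determined by its ends. For the same reason every set \<open>T\<close> of unused vertices
  that is feasible after \<open>\<sigma>\<close> splits into such paths, so by submodularity of \<open>g\<close> and modularity of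
  \<open>f\<close> no \<open>T\<close> is denser than the best path. The factor 4 then comes from the histogram argument of
  Feige, Lovasz and Tetali for min-sum set cover: the greedy cost is the area of a histogram which,
  shrunk by a factor of two in both directions, fits under the histogram of any feasible order.
\<close>

section \<open>Comparing two histograms\<close>

text \<open>In min-sum set cover, \<open>f\<close> counts the sets chosen so far and
  \<open>g\<close> the elements covered; here \<open>f\<close> acts as time and \<open>g\<close> as
  demand served. Whole paths compete rather than single vertices because a vertex of high density
  may be unlocked only by one of low density. The greedy order is charged as if all vertices of a
  path were finished at its end, while its competitor is charged vertex by vertex, so this coarser
  accounting costs no further factor. The machine cannot divide, and densities may be 0/0, so they
  are compared by cross-multiplication, which is not transitive. The search therefore replaces its
  candidate only by a strictly denser path, the one case in which earlier comparisons carry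
  over.\<close>

definition clip :: "real \<Rightarrow> real \<Rightarrow> real \<Rightarrow> real" where
  "clip l u x = max l (min u x)"

lemma clip_mono: "x \<le> y \<Longrightarrow> clip l u x \<le> clip l u y"
  by (auto simp: clip_def)

text \<open>Both sides are the length of the intersection of \<open>[l, u]\<close> and
  \<open>[l', u']\<close>, obtained by clipping one interval into the other.\<close>

lemma clip_diff_commute:
  assumes "l \<le> u" "l' \<le> u'"
  shows "clip l u u' - clip l u l' = clip l' u' u - clip l' u' l"
  using assms by (auto simp: clip_def max_def min_def)

text \<open>
  The column of height \<open>h i\<close> stands on \<open>[a (i + 1), a i]\<close>, and similarly for \<open>k\<close> and \<open>b\<close>. The overlap
  of two columns is a difference of clipped endpoints, so that its sum telescopes in either index.
\<close>

lemma histogram_le: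
  fixes a b h k :: "nat \<Rightarrow> real"
  assumes a: "\<And>i. i < m \<Longrightarrow> a (Suc i) \<le> a i" "a m = 0"
    and b: "\<And>j. j < n \<Longrightarrow> b (Suc j) \<le> b j" "b n = 0"
    and ab: "a 0 \<le> b 0"
    and k: "\<And>j. j < n \<Longrightarrow> 0 \<le> k j"
    and le: "\<And>i j. i < m \<Longrightarrow> j < n \<Longrightarrow> b (Suc j) < a i \<Longrightarrow> h i \<le> k j"
  shows "(\<Sum>i<m. (a i - a (Suc i)) * h i) \<le> (\<Sum>j<n. (b j - b (Suc j)) * k j)"
proof -
  have a_pos: "0 \<le> a i" if "i \<le> m" for i
    using that
  proof (induction rule: inc_induct)
    case (step i)
    with a(1)[of i] show ?case by simp
  qed (simp add: a)
  have a_le: "a i \<le> a 0" if "i \<le> m" for i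
    using that
  proof (induction i)
    case (Suc i)
    with a(1)[of i] show ?case by simp
  qed simp
  define w where "w i j = clip (a (Suc i)) (a i) (b j) - clip (a (Suc i)) (a i) (b (Suc j))" for i j
  have w': "w i j = clip (b (Suc j)) (b j) (a i) - clip (b (Suc j)) (b j) (a (Suc i))"
    if "i < m" "j < n" for i j
    unfolding w_def using a(1)[OF that(1)] b(1)[OF that(2)] by (rule clip_diff_commute)
  have w_pos: "0 \<le> w i j" if "j < n" for i j
    unfolding w_def using clip_mono[OF b(1)[OF that]] by simp
  \<comment> \<open>The \<open>k\<close> columns cover \<open>[0, b 0]\<close>, which contains the
    base of column \<open>i\<close>, so the overlaps exhaust its width. In \<open>col\<close> there
    is only an inequality, since the \<open>h\<close> columns may end before
    \<open>b 0\<close>.\<close>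
  have row: "(\<Sum>j<n. w i j) = a i - a (Suc i)" if "i < m" for i
  proof -
    have "(\<Sum>j<n. w i j) = clip (a (Suc i)) (a i) (b 0) - clip (a (Suc i)) (a i) (b n)"
      unfolding w_def by (rule sum_lessThan_telescope')
    also have "\<dots> = a i - a (Suc i)"
      using a_le[of i] a_pos[of "Suc i"] a(1)[of i] ab b(2) that by (simp add: clip_def)
    finally show ?thesis .
  qed
  have col: "(\<Sum>i<m. w i j) \<le> b j - b (Suc j)" if "j < n" for j
  proof -
    have "(\<Sum>i<m. w i j) = (\<Sum>i<m. clip (b (Suc j)) (b j) (a i) - clip (b (Suc j)) (b j) (a (Suc i)))"
      by (intro sum.cong refl w') (use that in auto)
    also have "\<dots> = clip (b (Suc j)) (b j) (a 0) - clip (b (Suc j)) (b j) (a m)"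
      by (rule sum_lessThan_telescope')
    also have "\<dots> \<le> b j - b (Suc j)"
      using b(1)[OF that] by (auto simp: clip_def)
    finally show ?thesis .
  qed
  have cell: "w i j * h i \<le> w i j * k j" if "i < m" "j < n" for i j
  proof (cases "b (Suc j) < a i")
    case True
    then show ?thesis using le w_pos that by (intro mult_left_mono) auto
  next
    case False
    then have "w i j = 0"
      using w'[OF that] b(1)[OF that(2)] a(1)[OF that(1)] by (simp add: clip_def)
    then show ?thesis by simp
  qed
  have "(\<Sum>i<m. (a i - a (Suc i)) * h i) = (\<Sum>i<m. \<Sum>j<n. w i j * h i)"
    by (simp add: row sum_distrib_right[symmetric])
  also have "\<dots> \<le> (\<Sum>i<m. \<Sum>j<n. w i j * k j)"
    by (intro sum_mono cell) auto
  also have "\<dots> = (\<Sum>j<n. (\<Sum>i<m. w i j) * k j)"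
    by (subst sum.swap) (simp add: sum_distrib_right)
  also have "\<dots> \<le> (\<Sum>j<n. (b j - b (Suc j)) * k j)"
    by (intro sum_mono mult_right_mono col k) auto
  finally show ?thesis .
qed

text \<open>Summation by parts: each increment of \<open>F\<close> is paid once for all of
  \<open>G\<close> that is still to be gained.\<close>

lemma sum_by_parts:
  fixes F G :: "nat \<Rightarrow> real"
  assumes "F 0 = 0"
  shows "(\<Sum>i<m. F (Suc i) * (G (Suc i) - G i)) = (\<Sum>i<m. (F (Suc i) - F i) * (G m - G i))"
proof (induction m)
  case (Suc m)
  have "(\<Sum>i<m. (F (Suc i) - F i) * (G (Suc m) - G i)) =
      (\<Sum>i<m. (F (Suc i) - F i) * (G m - G i) + (F (Suc i) - F i) * (G (Suc m) - G m))"
    by (intro sum.cong) (auto simp: algebra_simps)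
  also have "\<dots> = (\<Sum>i<m. (F (Suc i) - F i) * (G m - G i)) + F m * (G (Suc m) - G m)"
    using assms by (simp add: sum.distrib sum_distrib_right[symmetric] sum_lessThan_telescope)
  finally show ?case using Suc by (simp add: algebra_simps)
qed simp

text \<open>Step \<open>i\<close> pays \<open>(F (Suc i) - F i) * R i\<close>; spread evenly over
  the \<open>G\<close> gained in that step, this is the price \<open>p i\<close> per unit. Once the
  competitor has less than \<open>R i / 2\<close> left to gain, the greedy choice forces its
  \<open>F'\<close> to be at least \<open>p i / 2\<close>. Halving the widths and halving the
  heights each cost a factor 2.\<close>

lemma greedy_histogram:
  fixes F G F' G' :: "nat \<Rightarrow> real"
  assumes F: "F 0 = 0" "\<And>i. i < m \<Longrightarrow> F i \<le> F (Suc i)"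
    and G: "G 0 = 0" "\<And>i. i < m \<Longrightarrow> G i \<le> G (Suc i)"
    and F': "\<And>j. j \<le> n \<Longrightarrow> 0 \<le> F' j"
    and G': "G' 0 = 0" "\<And>j. j < n \<Longrightarrow> G' j \<le> G' (Suc j)"
    and W: "G m = G' n"
    and greedy: "\<And>i j. i < m \<Longrightarrow> j \<le> n \<Longrightarrow>
      (G' j - G i) * (F (Suc i) - F i) \<le> (G (Suc i) - G i) * F' j"
  shows "(\<Sum>i<m. F (Suc i) * (G (Suc i) - G i)) \<le> 4 * (\<Sum>j<n. F' (Suc j) * (G' (Suc j) - G' j))"
proof -
  define R where "R i = G m - G i" for i
  \<comment> \<open>the column heights of the greedy histogram, with junk value 0 for columns of width 0\<close>
  define p where "p i = R i * (F (Suc i) - F i) / (G (Suc i) - G i)" for i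
  have R_pos: "0 \<le> R i" if "i \<le> m" for i
    unfolding R_def using that
  proof (induction rule: inc_induct)
    case (step i)
    with G(2)[of i] show ?case by simp
  qed simp
  have p: "(G (Suc i) - G i) * p i = (F (Suc i) - F i) * R i" if "i < m" for i
  proof (cases "G (Suc i) = G i")
    \<comment> \<open>A step without gain in \<open>G\<close> cannot increase \<open>F\<close> while
      demand remains: comparison with the complete competitor, \<open>j = n\<close>, gives
      \<open>R i * (F (Suc i) - F i) \<le> 0\<close>. Hence both sides vanish and the junk value
      does no harm.\<close>
    case True
    with greedy[of i n] that W have "R i * (F (Suc i) - F i) \<le> 0"
      by (simp add: R_def)
    moreover have "0 \<le> R i * (F (Suc i) - F i)"
      using R_pos[of i] F(2)[OF that] that by simp
    ultimately show ?thesis using True by (simp add: mult.commute)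
  qed (simp add: p_def)
  have "(\<Sum>i<m. (R i / 2 - R (Suc i) / 2) * (p i / 2)) \<le>
      (\<Sum>j<n. ((G' n - G' j) - (G' n - G' (Suc j))) * F' (Suc j))"
  proof (rule histogram_le)
    show "R 0 / 2 \<le> G' n - G' 0"
      using R_pos[of 0] by (simp add: R_def G G' W)
    show "p i / 2 \<le> F' (Suc j)"
      if i: "i < m" and j: "j < n" and less: "G' n - G' (Suc j) < R i / 2" for i j
    proof (cases "G (Suc i) = G i")
      case True
      then show ?thesis using F'[of "Suc j"] j by (simp add: p_def)
    next
      case False
      with G(2)[OF i] have pos: "0 < G (Suc i) - G i" by simp
      \<comment> \<open>Both orders end at the same total, so a competitor with less than
        \<open>R i / 2\<close> left has gained more than \<open>R i / 2\<close> beyond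
        \<open>G i\<close>.\<close>
      have "R i / 2 * (F (Suc i) - F i) \<le> (G' (Suc j) - G i) * (F (Suc i) - F i)"
        using less F(2)[OF i] by (intro mult_right_mono) (auto simp: R_def W field_simps)
      also have "\<dots> \<le> (G (Suc i) - G i) * F' (Suc j)"
        using i j by (intro greedy) auto
      finally show ?thesis using pos by (simp add: p_def field_simps)
    qed
  qed (use G G' F' W in \<open>auto simp: R_def\<close>)
  moreover have "(\<Sum>i<m. (R i / 2 - R (Suc i) / 2) * (p i / 2)) =
      (\<Sum>i<m. F (Suc i) * (G (Suc i) - G i)) / 4"
  proof -
    have "(\<Sum>i<m. (R i / 2 - R (Suc i) / 2) * (p i / 2)) = (\<Sum>i<m. (G (Suc i) - G i) * p i) / 4"
      unfolding sum_divide_distrib by (intro sum.cong) (auto simp: R_def field_simps)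
    also have "(\<Sum>i<m. (G (Suc i) - G i) * p i) = (\<Sum>i<m. (F (Suc i) - F i) * R i)"
      by (intro sum.cong) (auto simp: p)
    finally show ?thesis using sum_by_parts[of F G m] F(1) by (simp add: R_def)
  qed
  ultimately show ?thesis by (simp add: mult.commute)
qed

lemma ordering_cost_append:
  "ordering_cost f g (\<sigma> @ [v]) =
     ordering_cost f g \<sigma> + f (set (\<sigma> @ [v])) * (g (set (\<sigma> @ [v])) - g (set \<sigma>))"
  by (simp add: ordering_cost_def)

lemma ordering_cost_lessThan:
  "ordering_cost f g \<sigma> =
     (\<Sum>j<length \<sigma>. f (set (take (Suc j) \<sigma>)) * (g (set (take (Suc j) \<sigma>)) - g (set (take j \<sigma>))))"
  unfolding ordering_cost_def by (rule sum.reindex_bij_witness[of _ Suc "\<lambda>j. j - 1"]) auto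

lemma ordering_cost_map:
  "ordering_cost f g (map h \<sigma>) = ordering_cost (\<lambda>A. f (h ` A)) (\<lambda>A. g (h ` A)) \<sigma>"
  by (simp add: ordering_cost_def take_map)


section \<open>The greedy algorithm\<close>

text \<open>The inforest enters only as an acyclic single-valued relation, so the theory can be
  instantiated directly with the vertex numbers on which the machine works.\<close>

locale or_ordering =
  fixes V :: "'a set" and E :: "'a rel" and f g :: "'a set \<Rightarrow> real"
  assumes finite_V: "finite V"
    and E_sub: "E \<subseteq> V \<times> V"
    and acyclic_E: "acyclic E"
    and single_valued_E: "single_valued E"
    and mono_f: "mono_on (Pow V) f" and mono_g: "mono_on (Pow V) g"
    and f_empty: "f {} = 0" and g_empty: "g {} = 0"
    and modular_f: "modular_on V f" and submodular_g: "submodular_on V g"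
begin

definition available :: "'a set \<Rightarrow> 'a \<Rightarrow> bool" where
  "available A v \<longleftrightarrow> (\<exists>u. (u, v) \<in> E) \<longrightarrow> (\<exists>u\<in>A. (u, v) \<in> E)"

definition feasible :: "'a list \<Rightarrow> bool" where
  "feasible \<sigma> \<longleftrightarrow> distinct \<sigma> \<and> set \<sigma> \<subseteq> V \<and> (\<forall>j<length \<sigma>. available (set (take j \<sigma>)) (\<sigma> ! j))"

text \<open>Availability is demanded of the head only: each later vertex is preceded on the path by
  one of its predecessors.\<close>

definition extension :: "'a set \<Rightarrow> 'a list \<Rightarrow> bool" where
  "extension A q \<longleftrightarrow> q \<noteq> [] \<and> distinct q \<and> set q \<subseteq> V - A \<and> available A (hd q) \<and>
     successively (\<lambda>u v. (u, v) \<in> E) q"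

text \<open>
  The comparison of densities is cross-multiplied. It is not transitive across a path of density
  \<open>0 / 0\<close>, which satisfies it with respect to every other path; such a path is a valid greedy choice.
\<close>

definition no_denser :: "'a set \<Rightarrow> 'a list \<Rightarrow> 'a list \<Rightarrow> bool" where
  "no_denser A p q \<longleftrightarrow>
     (g (A \<union> set q) - g A) * (f (A \<union> set p) - f A) \<le> (g (A \<union> set p) - g A) * (f (A \<union> set q) - f A)"

inductive greedy :: "'a list \<Rightarrow> bool" where
  greedy_Nil: "greedy []"
| greedy_append: "greedy \<sigma> \<Longrightarrow> extension (set \<sigma>) p \<Longrightarrow>
    (\<And>q. extension (set \<sigma>) q \<Longrightarrow> no_denser (set \<sigma>) p q) \<Longrightarrow> greedy (\<sigma> @ p)"

lemma finite_E: "finite E"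
  using E_sub finite_V by (meson finite_SigmaI finite_subset)

lemma available_mono: "available A v \<Longrightarrow> A \<subseteq> B \<Longrightarrow> available B v"
  by (auto simp: available_def)

lemma f_mono: "A \<subseteq> B \<Longrightarrow> B \<subseteq> V \<Longrightarrow> f A \<le> f B"
  using mono_f by (auto simp: mono_on_def)

lemma g_mono: "A \<subseteq> B \<Longrightarrow> B \<subseteq> V \<Longrightarrow> g A \<le> g B"
  using mono_g by (auto simp: mono_on_def)

lemma f_nonneg: "A \<subseteq> V \<Longrightarrow> 0 \<le> f A"
  using f_mono[of "{}" A] f_empty by simp

lemma f_Un_disjoint:
  assumes "A \<subseteq> V" "B \<subseteq> V" "A \<inter> B = {}"
  shows "f (A \<union> B) = f A + f B"
proof -
  from modular_f obtain c where "\<And>S. S \<subseteq> V \<Longrightarrow> f S = sum c S"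
    unfolding modular_on_def by metis
  with assms finite_V show ?thesis by (simp add: sum.union_disjoint finite_subset)
qed

lemma feasible_append:
  assumes "feasible \<sigma>" "extension (set \<sigma>) q"
  shows "feasible (\<sigma> @ q)"
  unfolding feasible_def
proof (intro conjI allI impI)
  fix j assume j: "j < length (\<sigma> @ q)"
  consider "j < length \<sigma>" | "j = length \<sigma>" | i where "j = length \<sigma> + Suc i"
    by (metis less_iff_Suc_add not_less_iff_gr_or_eq add_Suc_right)
  then show "available (set (take j (\<sigma> @ q))) ((\<sigma> @ q) ! j)"
  proof cases
    case 1
    then show ?thesis using assms by (simp add: feasible_def nth_append)
  next
    case 2
    then show ?thesis using assms by (auto simp: extension_def hd_conv_nth nth_append)
  next
    case (3 i)
    then have "(q ! i, q ! Suc i) \<in> E"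
      using assms j by (auto simp: extension_def successively_conv_nth)
    moreover have "q ! i \<in> set (take (Suc i) q)"
      using 3 j by (auto simp: in_set_conv_nth)
    ultimately show ?thesis using 3 by (auto simp: available_def nth_append)
  qed
qed (use assms in \<open>auto simp: feasible_def extension_def\<close>)

lemma greedy_feasible: "greedy \<sigma> \<Longrightarrow> feasible \<sigma>"
proof (induction rule: greedy.induct)
  case greedy_Nil
  show ?case by (simp add: feasible_def)
qed (rule feasible_append)

text \<open>The failing comparison says that \<open>q\<close> is strictly denser than
  \<open>p\<close>. This forces the \<open>f\<close>-increment of \<open>p\<close> to be positive,
  so it can be cancelled after chaining the two inequalities.\<close>

lemma no_denser_trans:
  assumes "A \<subseteq> V" "set p \<subseteq> V" "set q \<subseteq> V" "set r \<subseteq> V"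
    and "no_denser A p r" "\<not> no_denser A p q"
  shows "no_denser A q r"
proof -
  define fp fq fr where "fp = f (A \<union> set p) - f A" and "fq = f (A \<union> set q) - f A" and "fr = f (A \<union> set r) - f A"
  define gp gq gr where "gp = g (A \<union> set p) - g A" and "gq = g (A \<union> set q) - g A" and "gr = g (A \<union> set r) - g A"
  note defs = fp_def fq_def fr_def gp_def gq_def gr_def
  have pos: "0 \<le> fp" "0 \<le> fq" "0 \<le> fr" "0 \<le> gp" "0 \<le> gq"
    using assms(1-4) by (auto simp: defs f_mono g_mono)
  have 1: "gr * fp \<le> gp * fr" and 2: "gp * fq < gq * fp"
    using assms(5,6) by (auto simp: no_denser_def defs)
  from 2 pos have fp: "0 < fp"
    by (metis less_eq_real_def mult_eq_0_iff mult_nonneg_nonneg not_less)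
  have "gr * fq * fp \<le> gp * fr * fq"
    using mult_right_mono[OF 1 pos(2)] by (simp add: mult_ac)
  also have "\<dots> \<le> gq * fr * fp"
    using mult_right_mono[OF less_imp_le[OF 2] pos(3)] by (simp add: mult_ac)
  finally have "gr * fq \<le> gq * fr" using fp by simp
  then show ?thesis by (simp add: no_denser_def defs)
qed

lemma extension_exists:
  assumes "A \<subset> V"
  shows "\<exists>q. extension A q"
proof -
  \<comment> \<open>A vertex minimal among the remaining ones has all its predecessors in
    \<open>A\<close>, so it is an extension by itself.\<close>
  have "wf E" using finite_E acyclic_E by (simp add: finite_acyclic_wf)
  moreover from assms have "V - A \<noteq> {}" by auto
  ultimately obtain v where v: "v \<in> V - A" "\<And>u. (u, v) \<in> E \<Longrightarrow> u \<notin> V - A"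
    by (meson all_not_in_conv wfE_min)
  then have "available A v" using E_sub by (auto simp: available_def)
  with v have "extension A [v]" by (simp add: extension_def)
  then show ?thesis ..
qed

text \<open>Walk backwards from \<open>w\<close> along predecessors in \<open>T\<close> until a
  vertex is available from \<open>A\<close> alone; acyclicity ends the walk. The clause on
  \<open>E\<^sup>*\<close> is carried along because it shows that appending \<open>w\<close> keeps
  the path distinct.\<close>

lemma extension_ending_at:
  assumes T: "T \<subseteq> V - A" "\<And>v. v \<in> T \<Longrightarrow> available (A \<union> T) v" and w: "w \<in> T"
  shows "\<exists>q. extension A q \<and> set q \<subseteq> T \<and> last q = w \<and> (\<forall>x\<in>set q. (x, w) \<in> E\<^sup>*)"
  using finite_acyclic_wf[OF finite_E acyclic_E] w
proof (induction w rule: wf_induct_rule)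
  case (less w)
  show ?case
  proof (cases "available A w")
    case True
    with less T show ?thesis by (intro exI[of _ "[w]"]) (auto simp: extension_def)
  next
    case False
    with T(2)[OF less.prems] obtain u where u: "u \<in> T" "(u, w) \<in> E"
      by (auto simp: available_def)
    with less.IH obtain q where q: "extension A q" "set q \<subseteq> T" "last q = u" "\<forall>x\<in>set q. (x, u) \<in> E\<^sup>*"
      by blast
    have "w \<notin> set q"
      using q(4) u(2) acyclic_E by (meson acyclic_def rtrancl_into_trancl2)
    with q u less.prems T show ?thesis
      by (intro exI[of _ "q @ [w]"])
        (auto simp: extension_def successively_append_iff intro: rtrancl_into_rtrancl)
  qed
qed

text \<open>
  As every vertex has at most one successor, a feasible set of new vertices splits into
  directed paths that are feasible on their own; by subadditivity one of them is at least as dense.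
\<close>

lemma density_le:
  assumes A: "A \<subseteq> V" and "0 \<le> \<phi>"
    and paths: "\<And>q. extension A q \<Longrightarrow> (g (A \<union> set q) - g A) * \<phi> \<le> \<gamma> * (f (A \<union> set q) - f A)"
    and "T \<subseteq> V - A" "\<And>v. v \<in> T \<Longrightarrow> available (A \<union> T) v"
  shows "(g (A \<union> T) - g A) * \<phi> \<le> \<gamma> * f T"
  using assms(4,5)
proof (induction "card T" arbitrary: T rule: less_induct)
  case less
  have fin: "finite T" using less.prems(1) finite_V finite_subset by blast
  show ?case
  proof (cases "T = {}")
    case True
    then show ?thesis by (simp add: f_empty)
  next
    case False
    \<comment> \<open>Ending the path at a sink of \<open>T\<close> keeps the remainder feasible:
      every other path vertex has its only successor on the path, and \<open>r\<close> has no
      successor in \<open>T\<close>, so no remaining vertex relied on a removed one.\<close>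
    obtain r where r: "r \<in> T" "\<And>v. (r, v) \<in> E \<Longrightarrow> v \<notin> T"
      using finite_acyclic_wf_converse[OF finite_E acyclic_E] False
      by (metis all_not_in_conv converse_iff wfE_min)
    obtain q where q: "extension A q" "set q \<subseteq> T" "last q = r"
      using extension_ending_at[OF less.prems r(1)] by auto
    define T' where "T' = T - set q"
    have avail': "available (A \<union> T') v" if v: "v \<in> T'" for v
    proof (cases "\<exists>u. (u, v) \<in> E")
      case True
      then obtain u where u: "u \<in> A \<union> T" "(u, v) \<in> E"
        using less.prems(2)[of v] v by (auto simp: available_def T'_def)
      have "u \<notin> set q"
      proof
        assume "u \<in> set q"
        then obtain i where i: "i < length q" "q ! i = u" by (auto simp: in_set_conv_nth)
        show False
        proof (cases "Suc i < length q")
          case True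
          then have "(u, q ! Suc i) \<in> E"
            using q(1) i by (auto simp: extension_def successively_conv_nth)
          with u(2) single_valued_E have "v = q ! Suc i" by (auto dest: single_valuedD)
          with True v show False by (auto simp: T'_def)
        next
          case False
          with i have "i = length q - 1" by linarith
          with i q have "u = r" by (auto simp: extension_def last_conv_nth)
          with r u v show False by (auto simp: T'_def)
        qed
      qed
      with u show ?thesis by (auto simp: available_def T'_def)
    qed (auto simp: available_def)
    have "card T' < card T"
    proof (rule psubset_card_mono[OF fin])
      have "hd q \<in> set q" using q(1) by (simp add: extension_def)
      with q(2) show "T' \<subset> T" by (auto simp: T'_def)
    qed
    then have IH: "(g (A \<union> T') - g A) * \<phi> \<le> \<gamma> * f T'"
      using avail' less.prems(1) by (intro less.hyps) (auto simp: T'_def)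
    \<comment> \<open>The two sets meet exactly in \<open>A\<close>, so submodularity becomes
      subadditivity of the gains over \<open>A\<close>.\<close>
    have "g ((A \<union> set q) \<union> (A \<union> T')) + g ((A \<union> set q) \<inter> (A \<union> T')) \<le> g (A \<union> set q) + g (A \<union> T')"
    proof -
      have "A \<union> set q \<subseteq> V" "A \<union> T' \<subseteq> V" using A less.prems(1) q(2) by (auto simp: T'_def)
      then show ?thesis using submodular_g unfolding submodular_on_def by blast
    qed
    moreover have "(A \<union> set q) \<union> (A \<union> T') = A \<union> T" "(A \<union> set q) \<inter> (A \<union> T') = A"
      using q(2) less.prems(1) by (auto simp: T'_def)
    ultimately have "g (A \<union> T) - g A \<le> (g (A \<union> set q) - g A) + (g (A \<union> T') - g A)" by simp
    then have "(g (A \<union> T) - g A) * \<phi> \<le> (g (A \<union> set q) - g A) * \<phi> + (g (A \<union> T') - g A) * \<phi>"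
      using \<open>0 \<le> \<phi>\<close> by (metis distrib_right mult_right_mono)
    also have "\<dots> \<le> \<gamma> * (f (A \<union> set q) - f A) + \<gamma> * f T'"
      using paths[OF q(1)] IH by simp
    also have "f (A \<union> set q) - f A = f (set q)"
    proof -
      have "set q \<subseteq> V" "A \<inter> set q = {}" using less.prems(1) q(2) by auto
      then show ?thesis using f_Un_disjoint[OF A] by simp
    qed
    also have "\<gamma> * f (set q) + \<gamma> * f T' = \<gamma> * f T"
    proof -
      have T: "T = set q \<union> T'" and "set q \<subseteq> V" "T' \<subseteq> V" "set q \<inter> T' = {}"
        using q(2) less.prems(1) by (auto simp: T'_def)
      then have "f T = f (set q) + f T'" using f_Un_disjoint by metis
      then show ?thesis by (simp add: algebra_simps)
    qed
    finally show ?thesis .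
  qed
qed

text \<open>The new vertices of a prefix of \<open>\<tau>\<close> form a feasible set after
  \<open>\<sigma>\<close>, because the predecessor that \<open>\<tau>\<close> used is either in
  \<open>\<sigma>\<close> or itself new; so \<open>density_le\<close> applies. Passing from
  \<open>?S - ?A\<close> back to \<open>?S\<close> is monotonicity, of \<open>g\<close> on the left
  and of \<open>f\<close> on the right.\<close>

lemma greedy_density:
  assumes \<sigma>: "feasible \<sigma>" and p: "extension (set \<sigma>) p"
    and max: "\<And>q. extension (set \<sigma>) q \<Longrightarrow> no_denser (set \<sigma>) p q"
    and \<tau>: "feasible \<tau>" and j: "j \<le> length \<tau>"
  shows "(g (set (take j \<tau>)) - g (set \<sigma>)) * (f (set (\<sigma> @ p)) - f (set \<sigma>)) \<le>
    (g (set (\<sigma> @ p)) - g (set \<sigma>)) * f (set (take j \<tau>))"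
proof -
  let ?A = "set \<sigma>" and ?S = "set (take j \<tau>)"
  have sub: "?A \<subseteq> V" "?S \<subseteq> V" "set p \<subseteq> V"
    using \<sigma> \<tau> p by (auto simp: feasible_def extension_def dest: in_set_takeD)
  have f: "0 \<le> f (?A \<union> set p) - f ?A" and g: "0 \<le> g (?A \<union> set p) - g ?A"
    using sub by (auto simp: f_mono g_mono)
  have "(g ?S - g ?A) * (f (?A \<union> set p) - f ?A) \<le> (g (?A \<union> (?S - ?A)) - g ?A) * (f (?A \<union> set p) - f ?A)"
    using sub f by (intro mult_right_mono diff_right_mono g_mono) auto
  also have "\<dots> \<le> (g (?A \<union> set p) - g ?A) * f (?S - ?A)"
  proof (rule density_le)
    show "(g (?A \<union> set q) - g ?A) * (f (?A \<union> set p) - f ?A) \<le>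
        (g (?A \<union> set p) - g ?A) * (f (?A \<union> set q) - f ?A)" if "extension ?A q" for q
      using max[OF that] by (simp add: no_denser_def)
    show "available (?A \<union> (?S - ?A)) v" if "v \<in> ?S - ?A" for v
    proof -
      from that obtain i where "i < j" "i < length \<tau>" "v = \<tau> ! i" by (auto simp: in_set_conv_nth)
      moreover from this have "set (take i \<tau>) \<subseteq> ?A \<union> (?S - ?A)"
        using set_take_subset_set_take[of i j \<tau>] by auto
      ultimately show ?thesis
        using \<tau> by (auto simp: feasible_def intro: available_mono)
    qed
  qed (use sub f in auto)
  also have "\<dots> \<le> (g (?A \<union> set p) - g ?A) * f ?S"
    using sub g by (intro mult_left_mono f_mono) auto
  finally show ?thesis by simp
qed

text \<open>Every vertex of the block is charged the value of \<open>f\<close> at the end of the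
  block, which is the largest one in it.\<close>

lemma ordering_cost_append_le:
  assumes "set (\<sigma> @ q) \<subseteq> V"
  shows "ordering_cost f g (\<sigma> @ q) \<le>
    ordering_cost f g \<sigma> + f (set (\<sigma> @ q)) * (g (set (\<sigma> @ q)) - g (set \<sigma>))"
  using assms
proof (induction q rule: rev_induct)
  case (snoc v q)
  let ?A = "set (\<sigma> @ q)" and ?B = "set (\<sigma> @ q @ [v])"
  have "ordering_cost f g (\<sigma> @ q @ [v]) = ordering_cost f g (\<sigma> @ q) + f ?B * (g ?B - g ?A)"
    using ordering_cost_append[of f g "\<sigma> @ q" v] by simp
  also have "ordering_cost f g (\<sigma> @ q) \<le> ordering_cost f g \<sigma> + f ?A * (g ?A - g (set \<sigma>))"
    using snoc by simp
  also have "f ?A * (g ?A - g (set \<sigma>)) \<le> f ?B * (g ?A - g (set \<sigma>))"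
    using snoc.prems by (intro mult_right_mono) (auto intro!: f_mono g_mono)
  finally show ?case by (simp add: algebra_simps)
qed simp

text \<open>The predicate \<open>greedy\<close> forgets where its paths end. The sets
  \<open>A i\<close> recover these boundaries, the breakpoints of the greedy histogram, and one
  sequence serves all competitors \<open>\<tau>\<close>.\<close>

lemma greedy_blocks:
  assumes "greedy \<sigma>"
  shows "\<exists>m A. A 0 = {} \<and> A m = set \<sigma> \<and> (\<forall>i<m. A i \<subseteq> A (Suc i)) \<and> (\<forall>i\<le>m. A i \<subseteq> V) \<and>
    ordering_cost f g \<sigma> \<le> (\<Sum>i<m. f (A (Suc i)) * (g (A (Suc i)) - g (A i))) \<and>
    (\<forall>\<tau> i j. feasible \<tau> \<longrightarrow> i < m \<longrightarrow> j \<le> length \<tau> \<longrightarrow>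
      (g (set (take j \<tau>)) - g (A i)) * (f (A (Suc i)) - f (A i)) \<le>
      (g (A (Suc i)) - g (A i)) * f (set (take j \<tau>)))"
  using assms
proof induction
  case greedy_Nil
  show ?case by (intro exI[of _ "0::nat"] exI[of _ "\<lambda>_. {}"]) (simp add: ordering_cost_def)
next
  case (greedy_append \<sigma> p)
  from greedy_append.IH obtain m A where IH: "A 0 = {}" "A m = set \<sigma>" "\<And>i. i < m \<Longrightarrow> A i \<subseteq> A (Suc i)"
      "\<And>i. i \<le> m \<Longrightarrow> A i \<subseteq> V"
      "ordering_cost f g \<sigma> \<le> (\<Sum>i<m. f (A (Suc i)) * (g (A (Suc i)) - g (A i)))"
      "\<And>\<tau> i j. feasible \<tau> \<Longrightarrow> i < m \<Longrightarrow> j \<le> length \<tau> \<Longrightarrow>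
        (g (set (take j \<tau>)) - g (A i)) * (f (A (Suc i)) - f (A i)) \<le>
        (g (A (Suc i)) - g (A i)) * f (set (take j \<tau>))"
    by blast
  let ?B = "A(Suc m := set (\<sigma> @ p))"
  have feas: "feasible \<sigma>" using greedy_append.hyps(1) by (rule greedy_feasible)
  have "feasible (\<sigma> @ p)" using feas greedy_append.hyps(2) by (rule feasible_append)
  then have V: "set (\<sigma> @ p) \<subseteq> V" by (simp add: feasible_def)
  have "ordering_cost f g (\<sigma> @ p) \<le> (\<Sum>i<Suc m. f (?B (Suc i)) * (g (?B (Suc i)) - g (?B i)))"
    using ordering_cost_append_le[OF V] IH(2,5) by simp
  moreover have "(g (set (take j \<tau>)) - g (?B i)) * (f (?B (Suc i)) - f (?B i)) \<le>
      (g (?B (Suc i)) - g (?B i)) * f (set (take j \<tau>))"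
    if "feasible \<tau>" "i < Suc m" "j \<le> length \<tau>" for \<tau> i j
    using IH(6)[OF that(1) _ that(3)] greedy_density[OF feas greedy_append.hyps(2,3) that(1,3)] that(2)
    by (cases "i = m") (simp_all add: IH(2))
  ultimately show ?case
    using IH V by (intro exI[of _ "Suc m"] exI[of _ ?B]) (auto simp: less_Suc_eq le_Suc_eq)
qed

lemma greedy_approximation:
  assumes \<sigma>: "greedy \<sigma>" "set \<sigma> = V" and \<tau>: "feasible \<tau>" "set \<tau> = V"
  shows "ordering_cost f g \<sigma> \<le> 4 * ordering_cost f g \<tau>"
proof -
  from greedy_blocks[OF \<sigma>(1)] obtain m A where A: "A 0 = {}" "A m = V" "\<And>i. i < m \<Longrightarrow> A i \<subseteq> A (Suc i)"
      "\<And>i. i \<le> m \<Longrightarrow> A i \<subseteq> V"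
      "ordering_cost f g \<sigma> \<le> (\<Sum>i<m. f (A (Suc i)) * (g (A (Suc i)) - g (A i)))"
      "\<And>\<tau> i j. feasible \<tau> \<Longrightarrow> i < m \<Longrightarrow> j \<le> length \<tau> \<Longrightarrow>
        (g (set (take j \<tau>)) - g (A i)) * (f (A (Suc i)) - f (A i)) \<le>
        (g (A (Suc i)) - g (A i)) * f (set (take j \<tau>))"
    unfolding \<sigma>(2) by blast
  have A_Suc: "A (Suc i) \<subseteq> V" if "i < m" for i
    using A(4) that by (simp add: Suc_le_eq)
  have pre: "set (take j \<tau>) \<subseteq> V" for j
    using \<tau>(2) set_take_subset by metis
  note A(5)
  \<comment> \<open>The competitor is cut after every vertex, so its histogram sum is its exact
    cost.\<close>
  also have "(\<Sum>i<m. f (A (Suc i)) * (g (A (Suc i)) - g (A i))) \<le> 4 * ordering_cost f g \<tau>"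
    unfolding ordering_cost_lessThan[of f g \<tau>]
    by (rule greedy_histogram[where F = "\<lambda>i. f (A i)" and G = "\<lambda>i. g (A i)"
          and F' = "\<lambda>j. f (set (take j \<tau>))" and G' = "\<lambda>j. g (set (take j \<tau>))"])
      (use A(1-3,6) A_Suc \<tau> pre in \<open>simp_all add: f_empty g_empty f_mono g_mono f_nonneg
        set_take_subset_set_take\<close>)
  finally show ?thesis .
qed

end


section \<open>Total correctness with time bounds\<close>

text \<open>One halting run suffices for total correctness, as \<open>exec\<close> is deterministic.
  Time is only bounded from above, so that branches of different cost can share a bound.\<close>

definition runs :: "machine_input \<Rightarrow> com \<Rightarrow> state \<Rightarrow> nat \<Rightarrow> (state \<Rightarrow> bool) \<Rightarrow> bool" where
  "runs I c s T Q \<longleftrightarrow> (\<exists>t s'. exec I c s t s' \<and> t \<le> T \<and> Q s')"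

definition store :: "string \<Rightarrow> nat \<Rightarrow> nat \<Rightarrow> state \<Rightarrow> state" where
  "store x i k s = s\<lparr>nat_mem := (nat_mem s)(x := (nat_mem s x)(i := k))\<rparr>"

lemma nat_mem_store [simp]:
  "nat_mem (store x i k s) y = (if y = x then (nat_mem s x)(i := k) else nat_mem s y)"
  by (simp add: store_def)

lemma runs_weaken:
  assumes "runs I c s T P" "T \<le> T'" "\<And>s'. P s' \<Longrightarrow> Q s'"
  shows "runs I c s T' Q"
  using assms unfolding runs_def by (meson le_trans)

lemma runs_Skip: "Q s \<Longrightarrow> runs I Skip s 1 Q"
  unfolding runs_def by (intro exI[of _ 1] exI[of _ s]) (use exec.Skip in auto)

lemma runs_NAssign: "Q (store x (nval I a s) (nval I e s) s) \<Longrightarrow> runs I (NAssign x a e) s 1 Q"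
  unfolding runs_def store_def using exec.NAssign by blast

lemma runs_Seq:
  assumes "runs I c1 s T1 P" "\<And>s'. P s' \<Longrightarrow> runs I c2 s' T2 Q"
  shows "runs I (Seq c1 c2) s (T1 + T2) Q"
proof -
  from assms(1) obtain t1 s1 where 1: "exec I c1 s t1 s1" "t1 \<le> T1" "P s1"
    unfolding runs_def by blast
  from assms(2)[OF 1(3)] obtain t2 s2 where 2: "exec I c2 s1 t2 s2" "t2 \<le> T2" "Q s2"
    unfolding runs_def by blast
  from 1 2 show ?thesis unfolding runs_def
    by (intro exI[of _ "t1 + t2"] exI[of _ s2]) (auto intro: exec.Seq)
qed

lemma runs_Cond:
  assumes "bval I b s \<Longrightarrow> runs I c1 s T Q" "\<not> bval I b s \<Longrightarrow> runs I c2 s T Q"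
  shows "runs I (Cond b c1 c2) s (T + 1) Q"
proof (cases "bval I b s")
  case True
  with assms(1) obtain t s' where "exec I c1 s t s'" "t \<le> T" "Q s'" unfolding runs_def by blast
  with True show ?thesis unfolding runs_def
    by (intro exI[of _ "t + 1"] exI[of _ s']) (auto intro: exec.CondTrue simp del: One_nat_def add_Suc_right)
next
  case False
  with assms(2) obtain t s' where "exec I c2 s t s'" "t \<le> T" "Q s'" unfolding runs_def by blast
  with False show ?thesis unfolding runs_def
    by (intro exI[of _ "t + 1"] exI[of _ s']) (auto intro: exec.CondFalse simp del: One_nat_def add_Suc_right)
qed

text \<open>The variant \<open>m\<close> bounds the number of iterations and thus also yields the
  running time.\<close>

lemma runs_While:
  assumes step: "\<And>s. P s \<Longrightarrow> bval I b s \<Longrightarrow> runs I c s T (\<lambda>s'. P s' \<and> m s' < (m s :: nat))"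
    and "P s"
  shows "runs I (While b c) s ((T + 1) * m s + 1) (\<lambda>s'. P s' \<and> \<not> bval I b s')"
  using \<open>P s\<close>
proof (induction "m s" arbitrary: s rule: less_induct)
  case less
  show ?case
  proof (cases "bval I b s")
    case False
    then have "exec I (While b c) s 1 s" by (rule exec.WhileFalse)
    with False less.prems show ?thesis unfolding runs_def
      by (intro exI[of _ 1] exI[of _ s]) auto
  next
    case True
    obtain t1 s1 where 1: "exec I c s t1 s1" "t1 \<le> T" "P s1" "m s1 < m s"
      using step[OF less.prems True] unfolding runs_def by blast
    obtain t2 s2 where 2: "exec I (While b c) s1 t2 s2" "t2 \<le> (T + 1) * m s1 + 1" "P s2" "\<not> bval I b s2"
      using less.hyps[OF 1(4,3)] unfolding runs_def by blast
    have "(T + 1) * (m s1 + 1) \<le> (T + 1) * m s"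
      using 1(4) by (intro mult_le_mono2) simp
    then have "t1 + t2 + 1 \<le> (T + 1) * m s + 1"
      using 1(2) 2(2) by simp
    moreover have "exec I (While b c) s (t1 + t2 + 1) s2"
      using True 1(1) 2(1) by (rule exec.WhileTrue)
    ultimately show ?thesis using 2(3,4) unfolding runs_def by blast
  qed
qed

abbreviation var :: "string \<Rightarrow> nexp" where
  "var x \<equiv> NCell x (NConst 0)"

abbreviation assign :: "string \<Rightarrow> nexp \<Rightarrow> com" where
  "assign x e \<equiv> NAssign x (NConst 0) e"

abbreviation nonzero :: "nexp \<Rightarrow> bexp" where
  "nonzero e \<equiv> NLess (NConst 0) e"

definition For :: "string \<Rightarrow> com \<Rightarrow> com" where
  "For x c = Seq (assign x (NConst 0))
     (While (NLess (var x) NumVertices) (Seq c (assign x (NPlus (var x) (NConst 1)))))"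

text \<open>The invariant is required in the state after the counter has advanced, so it may speak
  about the whole memory. Each round adds one step for the increment and one for the test;
  initialisation and the last test give the final 2.\<close>

lemma runs_For:
  assumes init: "P 0 (store x 0 0 s)"
    and step: "\<And>i s. i < num_vertices I \<Longrightarrow> P i s \<Longrightarrow> nat_mem s x 0 = i \<Longrightarrow>
      runs I c s T (\<lambda>s'. nat_mem s' x 0 = i \<and> P (Suc i) (store x 0 (Suc i) s'))"
  shows "runs I (For x c) s ((T + 2) * num_vertices I + 2) (P (num_vertices I))"
proof -
  let ?n = "num_vertices I"
  let ?P = "\<lambda>s. P (nat_mem s x 0) s \<and> nat_mem s x 0 \<le> ?n"
  let ?loop = "While (NLess (var x) NumVertices) (Seq c (assign x (NPlus (var x) (NConst 1))))"
  have "runs I (Seq c (assign x (NPlus (var x) (NConst 1)))) s (T + 1)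
      (\<lambda>s'. ?P s' \<and> ?n - nat_mem s' x 0 < ?n - nat_mem s x 0)"
    if "?P s" "bval I (NLess (var x) NumVertices) s" for s
  proof (rule runs_Seq)
    show "runs I c s T (\<lambda>s'. nat_mem s' x 0 = nat_mem s x 0 \<and> P (Suc (nat_mem s x 0)) (store x 0 (Suc (nat_mem s x 0)) s'))"
      using that by (intro step) auto
    show "runs I (assign x (NPlus (var x) (NConst 1))) s' 1
        (\<lambda>s'. ?P s' \<and> ?n - nat_mem s' x 0 < ?n - nat_mem s x 0)"
      if "nat_mem s' x 0 = nat_mem s x 0 \<and> P (Suc (nat_mem s x 0)) (store x 0 (Suc (nat_mem s x 0)) s')" for s'
      using that \<open>bval I (NLess (var x) NumVertices) s\<close> by (intro runs_NAssign) auto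
  qed
  then have "runs I ?loop (store x 0 0 s) ((T + 1 + 1) * (?n - nat_mem (store x 0 0 s) x 0) + 1)
      (\<lambda>s'. ?P s' \<and> \<not> bval I (NLess (var x) NumVertices) s')"
  proof (rule runs_While)
    show "?P (store x 0 0 s)" using init by simp
  qed
  then have loop: "runs I ?loop (store x 0 0 s) ((T + 2) * ?n + 1) (P ?n)"
    by (rule runs_weaken) (auto dest: le_antisym)
  show ?thesis unfolding For_def
    by (rule runs_weaken, rule runs_Seq[where P = "\<lambda>s'. s' = store x 0 0 s"])
      (use loop in \<open>auto intro!: runs_NAssign\<close>)
qed

text \<open>Only natural-number cells are framed: the program never writes a real cell, since
  densities are compared directly on oracle values.\<close>

definition agree :: "string set \<Rightarrow> state \<Rightarrow> state \<Rightarrow> bool" where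
  "agree X s s' \<longleftrightarrow> (\<forall>x. x \<notin> X \<longrightarrow> nat_mem s' x = nat_mem s x)"

lemma agree_nat_mem: "agree X s s' \<Longrightarrow> x \<notin> X \<Longrightarrow> nat_mem s' x = nat_mem s x"
  by (simp add: agree_def)

lemma agree_store: "agree {x} s (store x i k s)"
  by (simp add: agree_def)


section \<open>The program\<close>

text \<open>The scan does not stop at a hit, so \<open>wit\<close> holds the last one. In
  \<open>walk_step\<close> the flag doubles as the loop guard \<open>go\<close>.\<close>

definition search :: "string \<Rightarrow> string \<Rightarrow> bexp \<Rightarrow> com" where
  "search flag wit b = Seq (assign flag (NConst 0))
     (For ''i'' (Cond b (Seq (assign wit (var ''i'')) (assign flag (NConst 1))) Skip))"

lemma runs_search:
  assumes b: "\<And>s' i. agree {flag, wit, ''i''} s s' \<Longrightarrow> nat_mem s' ''i'' 0 = i \<Longrightarrow> i < num_vertices I \<Longrightarrow>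
      bval I b s' \<longleftrightarrow> B i"
    and names: "flag \<noteq> ''i''" "wit \<noteq> ''i''" "flag \<noteq> wit"
  shows "runs I (search flag wit b) s (5 * num_vertices I + 3) (\<lambda>s'. agree {flag, wit, ''i''} s s' \<and>
    (if nat_mem s' flag 0 = 0 then \<forall>w<num_vertices I. \<not> B w
     else nat_mem s' wit 0 < num_vertices I \<and> B (nat_mem s' wit 0)))"
proof -
  let ?n = "num_vertices I"
  define P where "P i s' \<longleftrightarrow> agree {flag, wit, ''i''} s s' \<and>
    (if nat_mem s' flag 0 = 0 then \<forall>w<i. \<not> B w
     else nat_mem s' wit 0 < ?n \<and> B (nat_mem s' wit 0))" for i s'
  let ?body = "Cond b (Seq (assign wit (var ''i'')) (assign flag (NConst 1))) Skip"
  have body: "runs I ?body s' 3 (\<lambda>s''. nat_mem s'' ''i'' 0 = i \<and> P (Suc i) (store ''i'' 0 (Suc i) s''))"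
    if i: "i < ?n" "P i s'" "nat_mem s' ''i'' 0 = i" for i s'
  proof -
    have B: "bval I b s' \<longleftrightarrow> B i" using i by (intro b) (auto simp: P_def)
    have "runs I ?body s' (1 + 1 + 1) (\<lambda>s''. nat_mem s'' ''i'' 0 = i \<and> P (Suc i) (store ''i'' 0 (Suc i) s''))"
    proof (rule runs_Cond)
      assume "bval I b s'"
      with B i names show "runs I (Seq (assign wit (var ''i'')) (assign flag (NConst 1))) s' (1 + 1)
          (\<lambda>s''. nat_mem s'' ''i'' 0 = i \<and> P (Suc i) (store ''i'' 0 (Suc i) s''))"
        by (intro runs_Seq[where P = "\<lambda>s''. s'' = store wit 0 i s'"] runs_NAssign)
          (auto simp: P_def agree_def)
    next
      assume "\<not> bval I b s'"
      with B i names show "runs I Skip s' (1 + 1)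
          (\<lambda>s''. nat_mem s'' ''i'' 0 = i \<and> P (Suc i) (store ''i'' 0 (Suc i) s''))"
        by (intro runs_weaken[OF runs_Skip[where Q = "\<lambda>s''. s'' = s'"]])
          (auto simp: P_def agree_def less_Suc_eq)
    qed
    then show ?thesis by (simp add: numeral_3_eq_3)
  qed
  have "runs I (search flag wit b) s (1 + ((3 + 2) * ?n + 2)) (P ?n)"
    unfolding search_def
  proof (rule runs_Seq)
    show "runs I (assign flag (NConst 0)) s 1 (\<lambda>s'. s' = store flag 0 0 s)"
      by (rule runs_NAssign) simp
    show "runs I (For ''i'' ?body) s' ((3 + 2) * ?n + 2) (P ?n)" if "s' = store flag 0 0 s" for s'
      by (rule runs_For) (use body names that in \<open>auto simp: P_def agree_def\<close>)
  qed
  then show ?thesis by (rule runs_weaken) (auto simp: P_def)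
qed

text \<open>
  A list of distinct vertices is kept as the array of its elements, an array marking them, and
  its length.
\<close>

datatype list_var = List_Var (items: string) (marks: string) (len: string)

abbreviation names :: "list_var \<Rightarrow> string set" where
  "names X \<equiv> {items X, marks X, len X}"

definition holds :: "machine_input \<Rightarrow> list_var \<Rightarrow> nat list \<Rightarrow> state \<Rightarrow> bool" where
  "holds I X \<pi> s \<longleftrightarrow> nat_mem s (len X) 0 = length \<pi> \<and> length \<pi> \<le> num_vertices I \<and>
     set \<pi> \<subseteq> {..<num_vertices I} \<and> (\<forall>i<length \<pi>. nat_mem s (items X) i = \<pi> ! i) \<and>
     (\<forall>i<num_vertices I. 0 < nat_mem s (marks X) i \<longleftrightarrow> i \<in> set \<pi>)"

lemma holds_marked: "holds I X \<pi> s \<Longrightarrow> marked I s (marks X) = set \<pi>"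
  by (auto simp: holds_def marked_def)

lemma holds_agree: "agree Z s s' \<Longrightarrow> holds I X \<pi> s \<Longrightarrow> names X \<inter> Z = {} \<Longrightarrow> holds I X \<pi> s'"
  by (simp add: holds_def agree_def)

lemma holds_store: "holds I X \<pi> s \<Longrightarrow> x \<notin> names X \<Longrightarrow> holds I X \<pi> (store x i k s)"
  by (rule holds_agree[OF agree_store]) simp_all

definition push :: "list_var \<Rightarrow> nexp \<Rightarrow> com" where
  "push X e = Seq (NAssign (items X) (var (len X)) e)
     (Seq (NAssign (marks X) e (NConst 1)) (assign (len X) (NPlus (var (len X)) (NConst 1))))"

lemma runs_push:
  assumes "holds I X \<pi> s" "nat_mem s x 0 = v" "v < num_vertices I" "length \<pi> < num_vertices I"
    and "x \<notin> names X" "distinct [items X, marks X, len X]"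
  shows "runs I (push X (var x)) s 3 (\<lambda>s'. holds I X (\<pi> @ [v]) s' \<and> agree (names X) s s')"
proof -
  have "runs I (push X (var x)) s (1 + (1 + 1)) (\<lambda>s'. holds I X (\<pi> @ [v]) s' \<and> agree (names X) s s')"
    unfolding push_def
  proof (intro runs_Seq)
    show "runs I (NAssign (items X) (var (len X)) (var x)) s 1 (\<lambda>s'. s' = store (items X) (length \<pi>) v s)"
      using assms by (intro runs_NAssign) (simp add: holds_def)
    show "runs I (NAssign (marks X) (var x) (NConst 1)) s1 1
        (\<lambda>s'. s' = store (marks X) v 1 (store (items X) (length \<pi>) v s))"
      if "s1 = store (items X) (length \<pi>) v s" for s1
      using assms that by (intro runs_NAssign) auto
    show "runs I (assign (len X) (NPlus (var (len X)) (NConst 1))) s2 1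
        (\<lambda>s'. holds I X (\<pi> @ [v]) s' \<and> agree (names X) s s')"
      if "s2 = store (marks X) v 1 (store (items X) (length \<pi>) v s)" for s2
      using assms that
      by (intro runs_NAssign) (auto simp: holds_def agree_def nth_append less_Suc_eq)
  qed
  then show ?thesis by (simp add: numeral_3_eq_3)
qed

text \<open>All cells up to the number of vertices are copied, not just the list, so that stale
  marks in \<open>Y\<close> disappear.\<close>

definition copy :: "list_var \<Rightarrow> list_var \<Rightarrow> com" where
  "copy X Y = Seq (For ''i'' (Seq (NAssign (items Y) (var ''i'') (NCell (items X) (var ''i'')))
       (NAssign (marks Y) (var ''i'') (NCell (marks X) (var ''i'')))))
     (assign (len Y) (var (len X)))"

lemma runs_copy:
  assumes X: "holds I X \<pi> s"
    and names: "distinct [items X, marks X, len X, items Y, marks Y, len Y, ''i'']"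
  shows "runs I (copy X Y) s (4 * num_vertices I + 3)
    (\<lambda>s'. holds I Y \<pi> s' \<and> agree (names Y \<union> {''i''}) s s')"
proof -
  let ?n = "num_vertices I"
  define P where "P i s' \<longleftrightarrow> agree (names Y \<union> {''i''}) s s' \<and>
    (\<forall>j<i. nat_mem s' (items Y) j = nat_mem s (items X) j \<and>
      nat_mem s' (marks Y) j = nat_mem s (marks X) j)" for i s'
  let ?body = "Seq (NAssign (items Y) (var ''i'') (NCell (items X) (var ''i'')))
       (NAssign (marks Y) (var ''i'') (NCell (marks X) (var ''i'')))"
  have ne: "items Y \<noteq> marks Y" "marks Y \<noteq> items Y" "''i'' \<noteq> items Y" "''i'' \<noteq> marks Y"
    "items X \<noteq> items Y" "items X \<noteq> marks Y" "items X \<noteq> len Y" "items X \<noteq> ''i''"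
    "marks X \<noteq> items Y" "marks X \<noteq> marks Y" "marks X \<noteq> len Y" "marks X \<noteq> ''i''"
    "len X \<noteq> items Y" "len X \<noteq> marks Y" "len X \<noteq> ''i''"
    using names by auto
  have body: "runs I ?body s' 2 (\<lambda>s''. nat_mem s'' ''i'' 0 = i \<and> P (Suc i) (store ''i'' 0 (Suc i) s''))"
    if i: "i < ?n" "P i s'" "nat_mem s' ''i'' 0 = i" for i s'
  proof -
    have "runs I ?body s' (1 + 1) (\<lambda>s''. nat_mem s'' ''i'' 0 = i \<and> P (Suc i) (store ''i'' 0 (Suc i) s''))"
    proof (rule runs_Seq)
      show "runs I (NAssign (items Y) (var ''i'') (NCell (items X) (var ''i''))) s' 1
          (\<lambda>s''. s'' = store (items Y) i (nat_mem s (items X) i) s')"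
        using i ne by (intro runs_NAssign) (simp add: P_def agree_def)
      show "runs I (NAssign (marks Y) (var ''i'') (NCell (marks X) (var ''i''))) s1 1
          (\<lambda>s''. nat_mem s'' ''i'' 0 = i \<and> P (Suc i) (store ''i'' 0 (Suc i) s''))"
        if "s1 = store (items Y) i (nat_mem s (items X) i) s'" for s1
      proof (rule runs_NAssign)
        have "agree (names Y \<union> {''i''}) s s1"
          using i(2) that by (simp add: P_def agree_def)
        moreover have "\<forall>j<Suc i. nat_mem s1 (items Y) j = nat_mem s (items X) j"
          "\<forall>j<i. nat_mem s1 (marks Y) j = nat_mem s (marks X) j" "nat_mem s1 ''i'' 0 = i"
          using i ne that by (simp_all add: P_def All_less_Suc)
        ultimately show "nat_mem (store (marks Y) (nval I (var ''i'') s1) (nval I (NCell (marks X) (var ''i'')) s1) s1) ''i'' 0 = i \<and>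
            P (Suc i) (store ''i'' 0 (Suc i) (store (marks Y) (nval I (var ''i'') s1) (nval I (NCell (marks X) (var ''i'')) s1) s1))"
          using ne by (simp add: P_def agree_def All_less_Suc)
      qed
    qed
    then show ?thesis by (simp add: numeral_2_eq_2)
  qed
  have "runs I (copy X Y) s (((2 + 2) * ?n + 2) + 1)
      (\<lambda>s'. holds I Y \<pi> s' \<and> agree (names Y \<union> {''i''}) s s')"
    unfolding copy_def
  proof (rule runs_Seq)
    show "runs I (For ''i'' ?body) s ((2 + 2) * ?n + 2) (P ?n)"
      by (rule runs_For) (use body names in \<open>auto simp: P_def agree_def\<close>)
    show "runs I (assign (len Y) (var (len X))) s' 1
        (\<lambda>s'. holds I Y \<pi> s' \<and> agree (names Y \<union> {''i''}) s s')" if "P ?n s'" for s'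
      using that X names by (intro runs_NAssign) (auto simp: P_def holds_def agree_def)
  qed
  then show ?thesis by (rule runs_weaken) auto
qed

abbreviation (input) cur :: list_var where
  "cur \<equiv> List_Var ''out'' ''out_marks'' ''out_len''"

abbreviation (input) ext :: list_var where
  "ext \<equiv> List_Var ''ext'' ''ext_marks'' ''ext_len''"

abbreviation (input) best :: list_var where
  "best \<equiv> List_Var ''best'' ''best_marks'' ''best_len''"

abbreviation gain :: "list_var \<Rightarrow> rexp" where
  "gain X \<equiv> RMinus (QueryG (marks X)) (QueryG ''out_marks'')"

abbreviation weight :: "list_var \<Rightarrow> rexp" where
  "weight X \<equiv> RMinus (QueryF (marks X)) (QueryF ''out_marks'')"

text \<open>\<open>best\<close> and \<open>cur\<close> having the same length encodes that no path has been found yet.\<close>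

definition improves :: bexp where
  "improves = BNot (BAnd (NLess (var (len cur)) (var (len best)))
     (BNot (ProdLess (gain best) (weight ext) (gain ext) (weight best))))"

text \<open>By uniqueness of successors, the extensions with a given head are the nonempty prefixes
  of a single walk, and each is compared with \<open>best\<close> when the walk reaches it.\<close>

definition walk_step :: com where
  "walk_step = Seq (push ext (var ''u'')) (Seq (Cond improves (copy ext best) Skip)
     (Seq (search ''go'' ''w'' (BAnd (HasArc (var ''u'') (var ''i''))
         (BNot (nonzero (NCell (marks ext) (var ''i''))))))
       (assign ''u'' (var ''w''))))"

definition walk :: com where
  "walk = While (nonzero (var ''go'')) walk_step"

text \<open>\<open>ext\<close> starts as a copy of the current order, so its marks always represent
  the union on which the oracles have to be queried.\<close>

definition try_start :: com where
  "try_start = Seq (copy cur ext)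
     (Seq (search ''has_pred'' ''w'' (HasArc (var ''i'') (var ''v'')))
     (Seq (search ''has_done'' ''w'' (BAnd (HasArc (var ''i'') (var ''v'')) (nonzero (NCell (marks cur) (var ''i'')))))
     (Seq (Cond (BAnd (BNot (nonzero (NCell (marks cur) (var ''v''))))
           (BNot (BAnd (nonzero (var ''has_pred'')) (BNot (nonzero (var ''has_done''))))))
         (assign ''go'' (NConst 1)) (assign ''go'' (NConst 0)))
     (Seq (assign ''u'' (var ''v'')) walk))))"

text \<open>The last copy both commits the best path and resets the search, since equal lengths of
  \<open>best\<close> and \<open>cur\<close> mean that there is no candidate.\<close>

definition greedy_round :: com where
  "greedy_round = Seq (For ''v'' try_start) (copy best cur)"

definition greedy_program :: com where
  "greedy_program = While (NLess (var (len cur)) NumVertices) greedy_round"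

definition walk_time :: "nat \<Rightarrow> nat" where
  "walk_time n = (9 * n + 12) * n + 1"

definition start_time :: "nat \<Rightarrow> nat" where
  "start_time n = 14 * n + 12 + walk_time n"

definition round_time :: "nat \<Rightarrow> nat" where
  "round_time n = (start_time n + 2) * n + 2 + (4 * n + 3)"

definition program_time :: "nat \<Rightarrow> nat" where
  "program_time n = (round_time n + 1) * n + 1"

section \<open>Invariants and running time of the program\<close>

locale or_machine =
  or_ordering "{..<num_vertices I}" "{(i, j). adj I i j}" "f_oracle I" "g_oracle I"
  for I :: machine_input
begin

text \<open>The empty list stands for a missing candidate. Its increments are 0, so
  \<open>no_denser\<close> alone would let it win against every path.\<close>

definition beaten :: "nat set \<Rightarrow> nat list \<Rightarrow> nat list \<Rightarrow> bool" where
  "beaten A p q \<longleftrightarrow> p \<noteq> [] \<and> no_denser A p q"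

lemma extension_length:
  assumes "extension (set \<sigma>) q" "distinct \<sigma>" "set \<sigma> \<subseteq> {..<num_vertices I}"
  shows "length \<sigma> + length q \<le> num_vertices I"
proof -
  have "distinct (\<sigma> @ q)" "set (\<sigma> @ q) \<subseteq> {..<num_vertices I}"
    using assms by (auto simp: extension_def)
  then have "length (\<sigma> @ q) \<le> card {..<num_vertices I}"
    by (metis card_mono distinct_card finite_lessThan)
  then show ?thesis by simp
qed

definition round_inv :: "nat list \<Rightarrow> nat \<Rightarrow> nat list \<Rightarrow> bool" where
  "round_inv \<sigma> v p \<longleftrightarrow> (p = [] \<or> extension (set \<sigma>) p) \<and>
     (\<forall>q. extension (set \<sigma>) q \<and> hd q < v \<longrightarrow> beaten (set \<sigma>) p q)"

text \<open>\<open>q0\<close> has been pushed and \<open>u\<close> comes next. A path with head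
  \<open>v\<close> that is not yet beaten must still lie ahead on the walk, so none is left once
  \<open>go\<close> is cleared.\<close>

definition walk_inv :: "nat list \<Rightarrow> nat \<Rightarrow> nat list \<Rightarrow> nat list \<Rightarrow> bool \<Rightarrow> nat \<Rightarrow> bool" where
  "walk_inv \<sigma> v q0 p go u \<longleftrightarrow> round_inv \<sigma> v p \<and>
     (\<forall>q. extension (set \<sigma>) q \<and> hd q = v \<longrightarrow> beaten (set \<sigma>) p q \<or> go \<and> (\<exists>r. q = q0 @ u # r)) \<and>
     (go \<longrightarrow> extension (set \<sigma>) (q0 @ [u]))"

text \<open>This is where strictness of the update makes up for the lack of transitivity: everything
  beaten by the old candidate stays beaten by the new one.\<close>

lemma beaten_update:
  assumes "set \<sigma> \<subseteq> {..<num_vertices I}" "p = [] \<or> extension (set \<sigma>) p" "extension (set \<sigma>) q"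
    and "\<not> beaten (set \<sigma>) p q" "extension (set \<sigma>) r" "beaten (set \<sigma>) p r"
  shows "beaten (set \<sigma>) q r"
proof -
  have "no_denser (set \<sigma>) q r"
    by (rule no_denser_trans[where p = p]) (use assms in \<open>auto simp: beaten_def extension_def\<close>)
  with assms show ?thesis by (auto simp: beaten_def extension_def)
qed

lemma walk_inv_step:
  assumes inv: "walk_inv \<sigma> v q0 p True u" and \<sigma>: "set \<sigma> \<subseteq> {..<num_vertices I}"
    and p': "p' = (if beaten (set \<sigma>) p (q0 @ [u]) then p else q0 @ [u])"
    and go': "if go' then adj I u w \<and> w \<notin> set (\<sigma> @ q0 @ [u])
      else \<forall>w<num_vertices I. \<not> (adj I u w \<and> w \<notin> set (\<sigma> @ q0 @ [u]))"
  shows "walk_inv \<sigma> v (q0 @ [u]) p' go' w"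
proof -
  let ?q = "q0 @ [u]"
  have p: "p = [] \<or> extension (set \<sigma>) p" and q: "extension (set \<sigma>) ?q"
    using inv by (auto simp: walk_inv_def round_inv_def)
  have keep: "beaten (set \<sigma>) p' r" if "beaten (set \<sigma>) p r" "extension (set \<sigma>) r" for r
    using that beaten_update[OF \<sigma> p q] by (auto simp: p')
  have new: "beaten (set \<sigma>) p' ?q"
    by (auto simp: p' beaten_def no_denser_def)
  have verts: "adj I i j \<Longrightarrow> i < num_vertices I \<and> j < num_vertices I" for i j
    using E_sub by auto
  have unique: "adj I i j \<Longrightarrow> adj I i j' \<Longrightarrow> j = j'" for i j j'
    using single_valued_E by (auto simp: single_valued_def)
  have "round_inv \<sigma> v p'"
    using inv keep q by (auto simp: walk_inv_def round_inv_def p')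
  moreover have "beaten (set \<sigma>) p' r \<or> go' \<and> (\<exists>r'. r = ?q @ w # r')"
    if r: "extension (set \<sigma>) r" "hd r = v" for r
  proof (cases "beaten (set \<sigma>) p r")
    case True
    then show ?thesis using keep r by blast
  next
    case False
    with inv r obtain r0 where r0: "r = q0 @ u # r0" by (auto simp: walk_inv_def)
    show ?thesis
    \<comment> \<open>Either \<open>r\<close> is the path just compared, or it continues with an
      unmarked successor of \<open>u\<close>; that successor is unique, so the search has found
      it.\<close>
    proof (cases r0)
      case Nil
      with r0 new show ?thesis by simp
    next
      case (Cons x r1)
      with r(1) r0 have "adj I u x" "x \<notin> set (\<sigma> @ ?q)"
        by (auto simp: extension_def successively_append_iff)
      with go' unique verts have "go'" "x = w" by (metis (full_types))+
      with Cons r0 show ?thesis by simp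
    qed
  qed
  moreover have "extension (set \<sigma>) (?q @ [w])" if go'
    using go' that q verts by (auto simp: extension_def successively_append_iff hd_append)
  ultimately show ?thesis by (auto simp: walk_inv_def)
qed

definition walk_state :: "nat list \<Rightarrow> nat \<Rightarrow> state \<Rightarrow> bool" where
  "walk_state \<sigma> v s \<longleftrightarrow> (\<exists>q0 p. holds I cur \<sigma> s \<and> holds I ext (\<sigma> @ q0) s \<and> holds I best (\<sigma> @ p) s \<and>
     nat_mem s ''v'' 0 = v \<and> walk_inv \<sigma> v q0 p (nat_mem s ''go'' 0 \<noteq> 0) (nat_mem s ''u'' 0))"

lemma walk_stateI:
  assumes "holds I cur \<sigma> s" "holds I ext (\<sigma> @ q0) s" "holds I best (\<sigma> @ p) s" "nat_mem s ''v'' 0 = v"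
    "walk_inv \<sigma> v q0 p (nat_mem s ''go'' 0 \<noteq> 0) (nat_mem s ''u'' 0)"
  shows "walk_state \<sigma> v s"
  using assms unfolding walk_state_def by blast

text \<open>The value 0 for a cleared flag makes ending the walk count as progress, since the
  measure is positive as long as another vertex can be pushed.\<close>

definition walk_measure :: "state \<Rightarrow> nat" where
  "walk_measure s = (if nat_mem s ''go'' 0 = 0 then 0 else num_vertices I - nat_mem s ''ext_len'' 0)"

lemma improves_iff:
  assumes "holds I cur \<sigma> s" "holds I best (\<sigma> @ p) s" "holds I ext (\<sigma> @ q) s"
  shows "bval I improves s \<longleftrightarrow> \<not> beaten (set \<sigma>) p q"
proof -
  have "nat_mem s ''out_len'' 0 = length \<sigma>" "nat_mem s ''best_len'' 0 = length (\<sigma> @ p)"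
    using assms by (simp_all add: holds_def)
  moreover have "marked I s ''out_marks'' = set \<sigma>" "marked I s ''best_marks'' = set \<sigma> \<union> set p"
    "marked I s ''ext_marks'' = set \<sigma> \<union> set q"
    using holds_marked[OF assms(1)] holds_marked[OF assms(2)] holds_marked[OF assms(3)] by simp_all
  ultimately show ?thesis
    by (simp add: improves_def beaten_def no_denser_def not_less)
qed

lemma runs_walk_step:
  assumes s: "walk_state \<sigma> v s" and go: "nat_mem s ''go'' 0 \<noteq> 0" and \<sigma>: "distinct \<sigma>"
  shows "runs I walk_step s (9 * num_vertices I + 11)
    (\<lambda>s'. walk_state \<sigma> v s' \<and> walk_measure s' < walk_measure s)"
proof -
  let ?n = "num_vertices I"
  define u where "u = nat_mem s ''u'' 0"
  from s go obtain q0 p where cur: "holds I cur \<sigma> s" and ext: "holds I ext (\<sigma> @ q0) s"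
    and best: "holds I best (\<sigma> @ p) s" and v: "nat_mem s ''v'' 0 = v" and inv: "walk_inv \<sigma> v q0 p True u"
    by (auto simp: walk_state_def u_def)
  let ?q = "q0 @ [u]"
  define p' where "p' = (if beaten (set \<sigma>) p ?q then p else ?q)"
  have \<sigma>V: "set \<sigma> \<subseteq> {..<?n}" using cur by (simp add: holds_def)
  have q: "extension (set \<sigma>) ?q" using inv by (simp add: walk_inv_def)
  \<comment> \<open>As \<open>?q\<close> is still an extension, there is room for \<open>u\<close>:
    the push stays in bounds and the measure before the step is positive.\<close>
  then have len: "length (\<sigma> @ q0) < ?n" and u: "u < ?n"
    using extension_length[OF q \<sigma> \<sigma>V] by (auto simp: extension_def)
  define Q1 where "Q1 s' \<longleftrightarrow> holds I cur \<sigma> s' \<and> holds I ext (\<sigma> @ ?q) s' \<and>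
    nat_mem s' ''v'' 0 = v \<and> nat_mem s' ''u'' 0 = u" for s'
  have push: "runs I (push ext (var ''u'')) s 3 (\<lambda>s'. Q1 s' \<and> holds I best (\<sigma> @ p) s')"
  proof (rule runs_weaken[OF runs_push[OF ext _ u len]])
    fix s' assume s': "holds I ext ((\<sigma> @ q0) @ [u]) s' \<and> agree (names ext) s s'"
    then have A: "agree (names ext) s s'" ..
    show "Q1 s' \<and> holds I best (\<sigma> @ p) s'"
      using s' cur best v by (simp add: Q1_def u_def holds_agree[OF A] agree_nat_mem[OF A])
  qed (simp_all add: u_def)
  have compare: "runs I (Cond improves (copy ext best) Skip) s' (4 * ?n + 3 + 1)
      (\<lambda>s''. Q1 s'' \<and> holds I best (\<sigma> @ p') s'')" if s': "Q1 s' \<and> holds I best (\<sigma> @ p) s'" for s'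
  proof (rule runs_Cond)
    assume "bval I improves s'"
    with s' improves_iff have "p' = ?q" by (auto simp: p'_def Q1_def)
    then show "runs I (copy ext best) s' (4 * ?n + 3) (\<lambda>s''. Q1 s'' \<and> holds I best (\<sigma> @ p') s'')"
    proof (intro runs_weaken[OF runs_copy[where \<pi> = "\<sigma> @ ?q"]])
      fix s'' assume s'': "holds I best (\<sigma> @ ?q) s'' \<and> agree (names best \<union> {''i''}) s' s''"
      then have A: "agree (names best \<union> {''i''}) s' s''" ..
      show "Q1 s'' \<and> holds I best (\<sigma> @ p') s''"
        using s' s'' \<open>p' = ?q\<close> by (simp add: Q1_def holds_agree[OF A] agree_nat_mem[OF A])
    qed (use s' in \<open>simp_all add: Q1_def\<close>)
  next
    assume "\<not> bval I improves s'"
    with s' improves_iff have "p' = p" by (auto simp: p'_def Q1_def)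
    with s' show "runs I Skip s' (4 * ?n + 3) (\<lambda>s''. Q1 s'' \<and> holds I best (\<sigma> @ p') s'')"
      by (intro runs_weaken[OF runs_Skip[where Q = "\<lambda>s''. s'' = s'"]]) auto
  qed
  let ?B = "\<lambda>w. adj I u w \<and> w \<notin> set (\<sigma> @ ?q)"
  let ?b = "BAnd (HasArc (var ''u'') (var ''i'')) (BNot (nonzero (NCell (marks ext) (var ''i''))))"
  define Q2 where "Q2 s' \<longleftrightarrow> Q1 s' \<and> holds I best (\<sigma> @ p') s' \<and> (if nat_mem s' ''go'' 0 = 0 then \<forall>w<?n. \<not> ?B w
     else nat_mem s' ''w'' 0 < ?n \<and> ?B (nat_mem s' ''w'' 0))" for s'
  have search: "runs I (search ''go'' ''w'' ?b) s' (5 * ?n + 3) Q2"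
    if s': "Q1 s' \<and> holds I best (\<sigma> @ p') s'" for s'
  proof (rule runs_weaken[OF runs_search[where B = ?B]])
    show "bval I ?b s'' = ?B i" if "agree {''go'', ''w'', ''i''} s' s''" "nat_mem s'' ''i'' 0 = i" "i < ?n" for s'' i
    proof -
      have "holds I ext (\<sigma> @ ?q) s''" "nat_mem s'' ''u'' 0 = u"
        using s' by (simp_all add: Q1_def holds_agree[OF that(1)] agree_nat_mem[OF that(1)])
      with that show ?thesis by (auto simp: holds_def)
    qed
    show "Q2 s''" if "agree {''go'', ''w'', ''i''} s' s'' \<and> (if nat_mem s'' ''go'' 0 = 0 then \<forall>w<?n. \<not> ?B w
        else nat_mem s'' ''w'' 0 < ?n \<and> ?B (nat_mem s'' ''w'' 0))" for s''
    proof -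
      from that have A: "agree {''go'', ''w'', ''i''} s' s''" ..
      have "Q1 s''" "holds I best (\<sigma> @ p') s''"
        using s' by (simp_all add: Q1_def holds_agree[OF A] agree_nat_mem[OF A])
      with that show ?thesis unfolding Q2_def by blast
    qed
  qed auto
  have final: "runs I (assign ''u'' (var ''w'')) s' 1
      (\<lambda>s'. walk_state \<sigma> v s' \<and> walk_measure s' < walk_measure s)" if s': "Q2 s'" for s'
  proof (rule runs_NAssign)
    let ?s = "store ''u'' (nval I (NConst 0) s') (nval I (var ''w'') s') s'"
    have "walk_inv \<sigma> v ?q p' (nat_mem s' ''go'' 0 \<noteq> 0) (nat_mem s' ''w'' 0)"
      using s' by (intro walk_inv_step[OF inv \<sigma>V p'_def]) (auto simp: Q2_def split: if_splits)
    moreover have "holds I cur \<sigma> ?s" "holds I ext (\<sigma> @ ?q) ?s" "holds I best (\<sigma> @ p') ?s"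
      using s' by (simp_all add: Q2_def Q1_def holds_store)
    moreover have "walk_measure ?s < walk_measure s"
      using s' ext go len by (auto simp: walk_measure_def Q2_def Q1_def holds_def)
    ultimately show "walk_state \<sigma> v ?s \<and> walk_measure ?s < walk_measure s"
      using s' by (auto simp: Q2_def Q1_def intro!: walk_stateI[of _ _ ?q p'])
  qed
  have "runs I walk_step s (3 + ((4 * ?n + 3 + 1) + ((5 * ?n + 3) + 1)))
      (\<lambda>s'. walk_state \<sigma> v s' \<and> walk_measure s' < walk_measure s)"
    unfolding walk_step_def
    by (rule runs_Seq[OF push runs_Seq[OF compare runs_Seq[OF search final]]])
  then show ?thesis by (rule runs_weaken) auto
qed

lemma runs_walk:
  assumes "walk_state \<sigma> v s" "distinct \<sigma>"
  shows "runs I walk s (walk_time (num_vertices I))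
    (\<lambda>s'. \<exists>p. holds I cur \<sigma> s' \<and> holds I best (\<sigma> @ p) s' \<and> nat_mem s' ''v'' 0 = v \<and> round_inv \<sigma> (Suc v) p)"
proof -
  let ?n = "num_vertices I"
  have "runs I walk s ((9 * ?n + 11 + 1) * walk_measure s + 1)
      (\<lambda>s'. walk_state \<sigma> v s' \<and> \<not> bval I (nonzero (var ''go'')) s')"
    unfolding walk_def
    by (rule runs_While) (use assms runs_walk_step in auto)
  then show ?thesis
  proof (rule runs_weaken)
    have "walk_measure s \<le> ?n" by (simp add: walk_measure_def)
    then show "(9 * ?n + 11 + 1) * walk_measure s + 1 \<le> walk_time ?n"
      by (simp add: walk_time_def add.commute)
    \<comment> \<open>With \<open>go\<close> cleared, \<open>walk_inv\<close> leaves only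
      \<open>beaten\<close> for paths with head \<open>v\<close>, which extends the round invariant
      by this head.\<close>
    show "\<exists>p. holds I cur \<sigma> s' \<and> holds I best (\<sigma> @ p) s' \<and> nat_mem s' ''v'' 0 = v \<and> round_inv \<sigma> (Suc v) p"
      if "walk_state \<sigma> v s' \<and> \<not> bval I (nonzero (var ''go'')) s'" for s'
      using that by (auto simp: walk_state_def walk_inv_def round_inv_def less_Suc_eq)
  qed
qed

lemma runs_try_start:
  assumes cur: "holds I cur \<sigma> s" and best: "holds I best (\<sigma> @ p) s" and inv: "round_inv \<sigma> v p"
    and v: "nat_mem s ''v'' 0 = v" "v < num_vertices I" and \<sigma>: "distinct \<sigma>"
  shows "runs I try_start s (start_time (num_vertices I))
    (\<lambda>s'. \<exists>p. holds I cur \<sigma> s' \<and> holds I best (\<sigma> @ p) s' \<and> nat_mem s' ''v'' 0 = v \<and> round_inv \<sigma> (Suc v) p)"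
    (is "runs I _ s _ ?Q")
proof -
  let ?n = "num_vertices I"
  define Q where "Q s' \<longleftrightarrow> holds I cur \<sigma> s' \<and> holds I ext \<sigma> s' \<and> holds I best (\<sigma> @ p) s' \<and>
    nat_mem s' ''v'' 0 = v" for s'
  have Q_agree: "Q s''" if "Q s'" "agree Z s' s''" "Z \<subseteq> {''has_pred'', ''has_done'', ''go'', ''u'', ''w'', ''i''}" for Z s' s''
  proof -
    have A: "agree {''has_pred'', ''has_done'', ''go'', ''u'', ''w'', ''i''} s' s''"
      using that(2,3) by (auto simp: agree_def)
    show ?thesis
      using that(1) by (simp add: Q_def holds_agree[OF A] agree_nat_mem[OF A])
  qed
  have copy: "runs I (copy cur ext) s (4 * ?n + 3) Q"
  proof (rule runs_weaken[OF runs_copy[OF cur]])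
    fix s' assume s': "holds I ext \<sigma> s' \<and> agree (names ext \<union> {''i''}) s s'"
    then have A: "agree (names ext \<union> {''i''}) s s'" ..
    show "Q s'"
      using s' cur best v by (simp add: Q_def holds_agree[OF A] agree_nat_mem[OF A])
  qed simp_all
  let ?b1 = "HasArc (var ''i'') (var ''v'')"
  let ?b2 = "BAnd (HasArc (var ''i'') (var ''v'')) (nonzero (NCell (marks cur) (var ''i'')))"
  let ?B1 = "\<lambda>w. adj I w v"
  let ?B2 = "\<lambda>w. adj I w v \<and> w \<in> set \<sigma>"
  define Q1 where "Q1 s' \<longleftrightarrow> Q s' \<and> (nat_mem s' ''has_pred'' 0 = 0 \<longleftrightarrow> (\<forall>w<?n. \<not> ?B1 w))" for s'
  define Q2 where "Q2 s' \<longleftrightarrow> Q1 s' \<and> (nat_mem s' ''has_done'' 0 = 0 \<longleftrightarrow> (\<forall>w<?n. \<not> ?B2 w))" for s'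
  have search1: "runs I (search ''has_pred'' ''w'' ?b1) s' (5 * ?n + 3) Q1" if s': "Q s'" for s'
  proof (rule runs_weaken[OF runs_search[where B = ?B1]])
    show "bval I ?b1 s'' = ?B1 i"
      if "agree {''has_pred'', ''w'', ''i''} s' s''" "nat_mem s'' ''i'' 0 = i" for s'' i
      using Q_agree[OF s' that(1)] that(2) by (auto simp: Q_def)
    show "Q1 s''" if "agree {''has_pred'', ''w'', ''i''} s' s'' \<and>
        (if nat_mem s'' ''has_pred'' 0 = 0 then \<forall>w<?n. \<not> ?B1 w
         else nat_mem s'' ''w'' 0 < ?n \<and> ?B1 (nat_mem s'' ''w'' 0))" for s''
      using that Q_agree[OF s', of _ s''] by (auto simp: Q1_def split: if_splits)
  qed auto
  have search2: "runs I (search ''has_done'' ''w'' ?b2) s' (5 * ?n + 3) Q2" if s': "Q1 s'" for s'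
  proof (rule runs_weaken[OF runs_search[where B = ?B2]])
    show "bval I ?b2 s'' = ?B2 i"
      if "agree {''has_done'', ''w'', ''i''} s' s''" "nat_mem s'' ''i'' 0 = i" "i < ?n" for s'' i
    proof -
      have "Q s''" using Q_agree[OF _ that(1)] s' by (auto simp: Q1_def)
      with that(2,3) show ?thesis by (auto simp: Q_def holds_def)
    qed
    show "Q2 s''" if s'': "agree {''has_done'', ''w'', ''i''} s' s'' \<and>
        (if nat_mem s'' ''has_done'' 0 = 0 then \<forall>w<?n. \<not> ?B2 w
         else nat_mem s'' ''w'' 0 < ?n \<and> ?B2 (nat_mem s'' ''w'' 0))" for s''
    proof -
      have "Q s''" using Q_agree[of s' _ s''] s' s'' by (auto simp: Q1_def)
      moreover have "nat_mem s'' ''has_pred'' = nat_mem s' ''has_pred''"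
        using s'' by (auto simp: agree_def)
      ultimately have "Q1 s''" using s' by (simp add: Q1_def)
      with s'' show ?thesis unfolding Q2_def by (auto split: if_splits)
    qed
  qed auto
  define start where "start \<longleftrightarrow> v \<notin> set \<sigma> \<and> available (set \<sigma>) v"
  define Q3 where "Q3 s' \<longleftrightarrow> Q s' \<and> (nat_mem s' ''go'' 0 \<noteq> 0 \<longleftrightarrow> start)" for s'
  let ?b = "BAnd (BNot (nonzero (NCell (marks cur) (var ''v''))))
    (BNot (BAnd (nonzero (var ''has_pred'')) (BNot (nonzero (var ''has_done'')))))"
  have test: "runs I (Cond ?b (assign ''go'' (NConst 1)) (assign ''go'' (NConst 0))) s' (1 + 1) Q3"
    if s': "Q2 s'" for s'
  proof -
    have "nat_mem s' ''v'' 0 = v" "0 < nat_mem s' ''out_marks'' v \<longleftrightarrow> v \<in> set \<sigma>"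
      using s' v(2) by (simp_all add: Q2_def Q1_def Q_def holds_def)
    moreover have "nat_mem s' ''has_pred'' 0 = 0 \<longleftrightarrow> (\<nexists>w. adj I w v)"
      "nat_mem s' ''has_done'' 0 = 0 \<longleftrightarrow> (\<nexists>w. adj I w v \<and> w \<in> set \<sigma>)"
      using s' E_sub by (auto simp: Q2_def Q1_def)
    ultimately have "bval I ?b s' \<longleftrightarrow> start"
      unfolding start_def available_def by simp blast
    moreover have "Q (store ''go'' 0 k s')" for k
    proof (rule Q_agree[OF _ agree_store])
      show "Q s'" using s' by (simp add: Q2_def Q1_def)
    qed simp
    ultimately show ?thesis
      by (intro runs_Cond runs_NAssign) (auto simp: Q3_def)
  qed
  have assign: "runs I (assign ''u'' (var ''v'')) s' 1 (walk_state \<sigma> v)" if s': "Q3 s'" for s'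
  proof (rule runs_NAssign)
    let ?s = "store ''u'' (nval I (NConst 0) s') (nval I (var ''v'') s') s'"
    have "Q ?s"
    proof (rule Q_agree[OF _ agree_store])
      show "Q s'" using s' by (simp add: Q3_def)
    qed simp
    \<comment> \<open>If \<open>[v]\<close> is not an extension, no extension has head
      \<open>v\<close> and the walk is skipped; otherwise all of them begin with \<open>v\<close>,
      the next vertex to push.\<close>
    moreover have "walk_inv \<sigma> v [] p start v"
      unfolding walk_inv_def
    proof (intro conjI allI impI)
      fix q assume q: "extension (set \<sigma>) q \<and> hd q = v"
      then have "start" by (cases q) (auto simp: extension_def start_def)
      with q show "beaten (set \<sigma>) p q \<or> start \<and> (\<exists>r. q = [] @ v # r)"
        by (cases q) (auto simp: extension_def)
    qed (use inv v(2) in \<open>auto simp: start_def extension_def\<close>)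
    ultimately show "walk_state \<sigma> v ?s"
      using s' by (intro walk_stateI[of _ _ "[]" p]) (auto simp: Q_def Q3_def)
  qed
  have walk: "runs I walk s' (walk_time ?n) ?Q" if "walk_state \<sigma> v s'" for s'
    using that \<sigma> by (rule runs_walk)
  have "runs I try_start s ((4 * ?n + 3) + ((5 * ?n + 3) + ((5 * ?n + 3) + ((1 + 1) + (1 + walk_time ?n))))) ?Q"
    unfolding try_start_def
    by (rule runs_Seq[OF copy runs_Seq[OF search1 runs_Seq[OF search2 runs_Seq[OF test runs_Seq[OF assign walk]]]]])
  then show ?thesis by (rule runs_weaken) (auto simp: start_time_def)
qed

definition program_state :: "state \<Rightarrow> bool" where
  "program_state s \<longleftrightarrow> (\<exists>\<sigma>. holds I cur \<sigma> s \<and> holds I best \<sigma> s \<and> greedy \<sigma>)"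

lemma runs_greedy_round:
  assumes s: "program_state s" and less: "nat_mem s ''out_len'' 0 < num_vertices I"
  shows "runs I greedy_round s (round_time (num_vertices I)) (\<lambda>s'. program_state s' \<and>
    num_vertices I - nat_mem s' ''out_len'' 0 < num_vertices I - nat_mem s ''out_len'' 0)"
    (is "runs I _ s _ ?Q")
proof -
  let ?n = "num_vertices I"
  from s obtain \<sigma> where \<sigma>: "holds I cur \<sigma> s" "holds I best \<sigma> s" "greedy \<sigma>"
    unfolding program_state_def by blast
  have distinct: "distinct \<sigma>" using greedy_feasible[OF \<sigma>(3)] by (simp add: feasible_def)
  have sub: "set \<sigma> \<subseteq> {..<?n}" and len: "length \<sigma> < ?n"
    using \<sigma>(1) less by (auto simp: holds_def)
  define P where "P v s' \<longleftrightarrow> (\<exists>p. holds I cur \<sigma> s' \<and> holds I best (\<sigma> @ p) s' \<and> round_inv \<sigma> v p)" for v s'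
  have P_store: "P v (store ''v'' 0 k s')" if "P v s'" for v k s'
  proof -
    from that obtain p where "holds I cur \<sigma> s'" "holds I best (\<sigma> @ p) s'" "round_inv \<sigma> v p"
      unfolding P_def by blast
    then have "holds I cur \<sigma> (store ''v'' 0 k s')" "holds I best (\<sigma> @ p) (store ''v'' 0 k s')"
      by (simp_all add: holds_store)
    with \<open>round_inv \<sigma> v p\<close> show ?thesis unfolding P_def by blast
  qed
  have loop: "runs I (For ''v'' try_start) s ((start_time ?n + 2) * ?n + 2) (P ?n)"
  proof (rule runs_For)
    have "P 0 s" unfolding P_def using \<sigma> by (intro exI[of _ "[]"]) (simp add: round_inv_def)
    then show "P 0 (store ''v'' 0 0 s)" by (rule P_store)
    show "runs I try_start s' (start_time ?n)
        (\<lambda>s''. nat_mem s'' ''v'' 0 = v \<and> P (Suc v) (store ''v'' 0 (Suc v) s''))"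
      if v: "v < ?n" "P v s'" "nat_mem s' ''v'' 0 = v" for v s'
    proof -
      from v(2) obtain p where p: "holds I cur \<sigma> s'" "holds I best (\<sigma> @ p) s'" "round_inv \<sigma> v p"
        unfolding P_def by blast
      show ?thesis
      proof (rule runs_weaken[OF runs_try_start[OF p v(3,1) distinct]])
        fix s'' assume s'': "\<exists>p. holds I cur \<sigma> s'' \<and> holds I best (\<sigma> @ p) s'' \<and> nat_mem s'' ''v'' 0 = v \<and>
          round_inv \<sigma> (Suc v) p"
        then have "P (Suc v) s''" unfolding P_def by blast
        with s'' show "nat_mem s'' ''v'' 0 = v \<and> P (Suc v) (store ''v'' 0 (Suc v) s'')"
          by (blast intro: P_store)
      qed simp
    qed
  qed
  have copy: "runs I (copy best cur) s' (4 * ?n + 3) ?Q" if s': "P ?n s'" for s'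
  proof -
    from s' obtain p where p: "holds I cur \<sigma> s'" "holds I best (\<sigma> @ p) s'" "round_inv \<sigma> ?n p"
      unfolding P_def by blast
    have all: "beaten (set \<sigma>) p q" if "extension (set \<sigma>) q" for q
    proof -
      have "hd q \<in> set q" "set q \<subseteq> {..<?n}" using that by (auto simp: extension_def)
      then have "hd q < ?n" by auto
      with p(3) that show ?thesis by (auto simp: round_inv_def)
    qed
    \<comment> \<open>While a vertex is missing, some extension exists; as it is beaten, the
      candidate is a genuine path and the round makes progress.\<close>
    have "card (set \<sigma>) < card {..<?n}" using len distinct by (simp add: distinct_card)
    with sub have "set \<sigma> \<subset> {..<?n}" by auto
    then obtain q where "extension (set \<sigma>) q" using extension_exists by blast
    with all have ne: "p \<noteq> []" unfolding beaten_def by blast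
    with p(3) have "extension (set \<sigma>) p" by (simp add: round_inv_def)
    with all have g: "greedy (\<sigma> @ p)" by (intro greedy_append[OF \<sigma>(3)]) (auto simp: beaten_def)
    show ?thesis
    proof (rule runs_weaken[OF runs_copy[OF p(2)]])
      fix s'' assume s'': "holds I cur (\<sigma> @ p) s'' \<and> agree (names cur \<union> {''i''}) s' s''"
      then have A: "agree (names cur \<union> {''i''}) s' s''" ..
      have "holds I best (\<sigma> @ p) s''" using p(2) by (simp add: holds_agree[OF A])
      with s'' g have "program_state s''" unfolding program_state_def by blast
      moreover have "nat_mem s'' ''out_len'' 0 = length \<sigma> + length p" "nat_mem s ''out_len'' 0 = length \<sigma>"
        using s'' \<sigma>(1) by (auto simp: holds_def)
      ultimately show "?Q s''" using ne len by (cases p) auto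
    qed auto
  qed
  have "runs I greedy_round s (((start_time ?n + 2) * ?n + 2) + (4 * ?n + 3)) ?Q"
    unfolding greedy_round_def by (rule runs_Seq[OF loop copy])
  then show ?thesis by (simp add: round_time_def)
qed

lemma runs_greedy_program:
  "runs I greedy_program init (program_time (num_vertices I))
    (\<lambda>s. \<exists>\<sigma>. greedy \<sigma> \<and> set \<sigma> = {..<num_vertices I} \<and> (\<forall>j<num_vertices I. nat_mem s ''out'' j = \<sigma> ! j))"
proof -
  let ?n = "num_vertices I"
  let ?b = "NLess (var (len cur)) NumVertices"
  have "program_state init"
    unfolding program_state_def
    by (intro exI[of _ "[]"]) (auto simp: holds_def init_def intro: greedy_Nil)
  then have "runs I greedy_program init ((round_time ?n + 1) * (?n - nat_mem init ''out_len'' 0) + 1)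
      (\<lambda>s. program_state s \<and> \<not> bval I ?b s)"
    unfolding greedy_program_def
    by (intro runs_While) (use runs_greedy_round in auto)
  then show ?thesis
  proof (rule runs_weaken)
    fix s assume s: "program_state s \<and> \<not> bval I ?b s"
    then obtain \<sigma> where \<sigma>: "holds I cur \<sigma> s" "greedy \<sigma>" unfolding program_state_def by blast
    then have "distinct \<sigma>" using greedy_feasible by (auto simp: feasible_def)
    moreover have len: "length \<sigma> = ?n" and "set \<sigma> \<subseteq> {..<?n}" using s \<sigma>(1) by (auto simp: holds_def)
    ultimately have "set \<sigma> = {..<?n}" by (intro card_subset_eq) (auto simp: distinct_card)
    with \<sigma> len show "\<exists>\<sigma>. greedy \<sigma> \<and> set \<sigma> = {..<?n} \<and> (\<forall>j<?n. nat_mem s ''out'' j = \<sigma> ! j)"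
      by (auto simp: holds_def)
  qed (simp add: program_time_def init_def)
qed

end


section \<open>Inforests\<close>

text \<open>Inforests bound out-degrees only within components; this star places two arcs with a
  common tail in one connected subgraph.\<close>

lemma connected_out_star:
  assumes "wf_digraph G" "a \<in> arcs G" "b \<in> arcs G" "tail G a = tail G b"
  defines "H \<equiv> \<lparr>verts = {tail G a, head G a, head G b}, arcs = {a, b}, tail = tail G, head = head G\<rparr>"
  shows "subgraph H G" "Digraph_Component.connected H"
proof -
  interpret G: wf_digraph G by fact
  interpret H: wf_digraph H
    by unfold_locales (auto simp: H_def assms(4))
  show "subgraph H G"
    using assms G.wf_digraph H.wf_digraph by (auto simp: subgraph_def compatible_def H_def)
  interpret S: pair_wf_digraph "mk_symmetric H" by (rule H.wellformed_mk_symmetric)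
  have star: "tail G a \<rightarrow>\<^sup>*\<^bsub>mk_symmetric H\<^esub> v \<and> v \<rightarrow>\<^sup>*\<^bsub>mk_symmetric H\<^esub> tail G a" if "v \<in> verts H" for v
  proof -
    have "parcs (mk_symmetric H) = {(tail G a, head G a), (head G a, tail G a), (tail G a, head G b), (head G b, tail G a)}"
      using assms(4) by (auto simp: parcs_mk_symmetric H_def)
    moreover have "verts H = {tail G a, head G a, head G b}" by (simp add: H_def)
    ultimately show ?thesis
      using that by (auto intro: S.reachable_refl S.reachable_adjI)
  qed
  show "Digraph_Component.connected H"
  proof (rule H.connectedI)
    fix u v assume "u \<in> verts H" "v \<in> verts H"
    then show "u \<rightarrow>\<^sup>*\<^bsub>mk_symmetric H\<^esub> v" using star S.reachable_trans by blast
  qed (simp add: H_def)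
qed

text \<open>Among the subgraphs with \<open>P\<close> that contain \<open>H0\<close>, one with the
  most vertices and arcs together is maximal for inclusion; finiteness bounds this count.\<close>

lemma subgraph_of_max_subgraph:
  assumes "fin_digraph G" "subgraph H0 G" "P H0"
  shows "\<exists>H. pre_digraph.max_subgraph G P H \<and> subgraph H0 H"
proof -
  interpret fin_digraph G by fact
  define Q where "Q H \<longleftrightarrow> subgraph H G \<and> P H \<and> subgraph H0 H" for H
  have size_le: "card (verts H) \<le> card (verts G)" "card (arcs H) \<le> card (arcs G)" if "subgraph H G" for H
    using that by (auto simp: subgraph_def intro: card_mono)
  have "Q H0" using assms by (auto simp: Q_def subgraph_def compatible_def)
  moreover have "\<forall>H. Q H \<longrightarrow> card (verts H) + card (arcs H) < card (verts G) + card (arcs G) + 1"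
    using size_le by (simp add: Q_def add_mono le_imp_less_Suc)
  ultimately obtain H where H: "Q H"
    "\<And>H'. Q H' \<Longrightarrow> card (verts H') + card (arcs H') \<le> card (verts H) + card (arcs H)"
    using ex_has_greatest_nat[of Q H0 "\<lambda>H. card (verts H) + card (arcs H)"] by blast
  have "H' = H" if H': "subgraph H H'" "subgraph H' G" "P H'" for H'
  proof -
    have "Q H'" using H' H(1) by (auto simp: Q_def intro: subgraph_trans)
    have fin: "finite (verts H')" "finite (arcs H')"
      using H'(2) finite_subset[OF _ finite_verts] finite_subset[OF _ finite_arcs]
      by (simp_all add: subgraph_def)
    have sub: "verts H \<subseteq> verts H'" "arcs H \<subseteq> arcs H'"
      using H'(1) by (auto simp: subgraph_def)
    have "verts H = verts H'" "arcs H = arcs H'"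
      using H(2)[OF \<open>Q H'\<close>] card_mono[OF fin(1) sub(1)] card_mono[OF fin(2) sub(2)]
        card_subset_eq[OF fin(1) sub(1)] card_subset_eq[OF fin(2) sub(2)] by linarith+
    with H' show ?thesis by (auto simp: subgraph_def compatible_def)
  qed
  with H(1) have "max_subgraph P H" by (auto simp: max_subgraph_def Q_def)
  with H(1) show ?thesis by (auto simp: Q_def)
qed

text \<open>Two arcs out of \<open>u\<close> lie in a common component, an intree, where the
  out-degree bound makes them equal.\<close>

lemma inforest_single_valued:
  assumes "inforest G"
  shows "single_valued (arcs_ends G)"
proof (rule single_valuedI)
  fix u v w assume uv: "(u, v) \<in> arcs_ends G" and uw: "(u, w) \<in> arcs_ends G"
  interpret digraph G using assms by (simp add: inforest_def dag_def)
  from uv uw obtain a b where ab: "a \<in> arcs G" "b \<in> arcs G" "tail G a = u" "head G a = v" "tail G b = u" "head G b = w"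
    by (auto simp: arcs_ends_conv)
  then have "tail G a = tail G b" by simp
  from connected_out_star[OF wf_digraph_axioms ab(1,2) this]
  obtain H where H: "max_subgraph Digraph_Component.connected H"
    and sub: "subgraph \<lparr>verts = {tail G a, head G a, head G b}, arcs = {a, b}, tail = tail G, head = head G\<rparr> H"
    using subgraph_of_max_subgraph[OF fin_digraph_axioms] by blast
  from H assms have it: "intree H" by (simp add: inforest_def)
  then interpret H: digraph H by (simp add: intree_def dag_def)
  have out: "{a, b} \<subseteq> out_arcs H u" "u \<in> verts H"
    using sub ab by (auto simp: subgraph_def compatible_def)
  with it have "card (out_arcs H u) \<le> 1" by (simp add: intree_def out_degree_def)
  with out have "a = b" using card_le_Suc0_iff_eq[OF H.finite_out_arcs] by auto
  with ab show "v = w" by simp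
qed


section \<open>Presenting an instance to the machine\<close>

text \<open>The numbering is injective and maps arcs to arcs, so cycles would map to cycles, while
  sums and intersections are preserved when \<open>f\<close> and \<open>g\<close> are pulled
  back.\<close>

lemma or_machine_present:
  assumes G: "inforest G" and vs: "vs \<in> permutations_of_set (verts G)"
    and f: "mono_on (Pow (verts G)) f" "f {} = 0" "modular_on (verts G) f"
    and g: "mono_on (Pow (verts G)) g" "g {} = 0" "submodular_on (verts G) g"
  shows "or_machine (present vs G f g)"
proof -
  let ?V = "{..<length vs}" and ?h = "(!) vs"
  let ?E = "{(i, j). adj (present vs G f g) i j}"
  have vs': "set vs = verts G" "distinct vs" using vs by (auto simp: permutations_of_set_def)
  then have h: "inj_on ?h ?V" "\<And>A. A \<subseteq> ?V \<Longrightarrow> ?h ` A \<subseteq> verts G"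
    by (auto simp: inj_on_nth set_conv_nth)
  have inj: "inj_on ?h A" if "A \<subseteq> ?V" for A
    using h(1) that by (blast intro: inj_on_subset)
  have "acyclic ?E"
  proof -
    have hom: "(?h i, ?h j) \<in> (arcs_ends G)\<^sup>+" if "(i, j) \<in> ?E\<^sup>+" for i j
      using that by (induction) (auto simp: present_def intro: trancl_into_trancl)
    then show ?thesis using G by (auto simp: inforest_def dag_def acyclic_def)
  qed
  moreover have "single_valued ?E"
    using inforest_single_valued[OF G] nth_eq_iff_index_eq[OF vs'(2)]
    by (auto simp: single_valued_def present_def) blast
  moreover have "mono_on (Pow ?V) (\<lambda>A. f (?h ` A))" "mono_on (Pow ?V) (\<lambda>A. g (?h ` A))"
    using h(2) by (auto intro!: mono_onI mono_onD[OF f(1)] mono_onD[OF g(1)])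
  moreover have "modular_on ?V (\<lambda>A. f (?h ` A))"
  proof -
    from f(3) obtain c where "\<And>S. S \<subseteq> verts G \<Longrightarrow> f S = sum c S" unfolding modular_on_def by metis
    then have "f (?h ` A) = (\<Sum>i\<in>A. c (?h i))" if "A \<subseteq> ?V" for A
      using h(2)[OF that] inj[OF that] by (simp add: sum.reindex)
    then show ?thesis unfolding modular_on_def by blast
  qed
  moreover have "submodular_on ?V (\<lambda>A. g (?h ` A))"
    unfolding submodular_on_def
  proof (intro allI impI)
    fix S T assume ST: "S \<subseteq> ?V" "T \<subseteq> ?V"
    then show "g (?h ` (S \<union> T)) + g (?h ` (S \<inter> T)) \<le> g (?h ` S) + g (?h ` T)"
      using g(3) h(2)[of S] h(2)[of T] inj_on_image_Int[OF h(1) ST]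
      by (auto simp: submodular_on_def image_Un)
  qed
  ultimately show ?thesis
    using f g by unfold_locales (auto simp: present_def)
qed

lemma (in or_machine) or_feasible_iff:
  assumes I: "I = present vs G f g" and vs: "vs \<in> permutations_of_set (verts G)"
    and wf: "wf_digraph G"
  shows "\<tau> \<in> or_feasible G \<longleftrightarrow> (\<exists>\<pi>. \<tau> = map ((!) vs) \<pi> \<and> feasible \<pi> \<and> set \<pi> = {..<length vs})"
proof -
  let ?V = "{..<length vs}" and ?h = "(!) vs"
  have vs': "set vs = verts G" "distinct vs" using vs by (auto simp: permutations_of_set_def)
  then have bij: "bij_betw ?h ?V (verts G)" by (auto simp: bij_betw_nth)
  have n: "card (verts G) = length vs" using vs' by (metis distinct_card)
  have nI: "num_vertices I = length vs" by (simp add: I present_def)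
  \<comment> \<open>Well-formedness puts every predecessor among the vertices, so each has a
    number.\<close>
  have pred: "preds G (?h i) = ?h ` {j. adj I j i}" if "i < length vs" for i
  proof -
    have "u \<in> ?h ` {j. adj I j i}" if "(u, ?h i) \<in> arcs_ends G" for u
    proof -
      have "u \<in> set vs" using that wf vs'(1) by (auto simp: arcs_ends_conv wf_digraph_def)
      then obtain j where "j < length vs" "u = ?h j" by (auto simp: in_set_conv_nth)
      with that \<open>i < length vs\<close> show ?thesis by (auto simp: I present_def)
    qed
    then show ?thesis by (auto simp: preds_def I present_def)
  qed
  have avail: "(preds G (?h i) \<noteq> {} \<longrightarrow> preds G (?h i) \<inter> ?h ` A \<noteq> {}) \<longleftrightarrow> available A i"
    if "i < length vs" "A \<subseteq> ?V" for i A
  proof -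
    have "?h ` {j. adj I j i} \<inter> ?h ` A = ?h ` ({j. adj I j i} \<inter> A)"
      using that by (intro inj_on_image_Int[symmetric, OF bij_betw_imp_inj_on[OF bij]])
        (auto simp: I present_def)
    then show ?thesis unfolding pred[OF that(1)] by (auto simp: available_def)
  qed
  have main: "map ?h \<pi> \<in> or_feasible G \<longleftrightarrow> feasible \<pi>" if "set \<pi> = ?V" "distinct \<pi>" for \<pi>
  proof -
    have len: "length \<pi> = length vs" using that by (metis card_lessThan distinct_card)
    have "map ?h \<pi> \<in> permutations_of_set (verts G)"
      using that bij by (auto simp: permutations_of_set_def distinct_map bij_betw_def)
    moreover have "set (take j \<pi>) \<subseteq> ?V" "\<pi> ! j < length vs" if "j < length vs" for j
      using set_take_subset[of j \<pi>] nth_mem[of j \<pi>] that \<open>set \<pi> = ?V\<close> len by auto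
    moreover have "feasible \<pi> \<longleftrightarrow> (\<forall>j<length vs. available (set (take j \<pi>)) (\<pi> ! j))"
      unfolding feasible_def using that len nI by simp
    ultimately show ?thesis
      using len avail by (simp add: or_feasible_def n take_map)
  qed
  show ?thesis
  proof
    assume \<tau>: "\<tau> \<in> or_feasible G"
    then have "set \<tau> = verts G" "distinct \<tau>" by (auto simp: or_feasible_def permutations_of_set_def)
    define \<pi> where "\<pi> = map (inv_into ?V ?h) \<tau>"
    have bij': "bij_betw (inv_into ?V ?h) (verts G) ?V" using bij by (rule bij_betw_inv_into)
    have "\<tau> = map ?h \<pi>"
      unfolding \<pi>_def using \<open>set \<tau> = verts G\<close> bij
      by (auto simp: bij_betw_inv_into_right intro!: map_idI[symmetric])
    moreover have "set \<pi> = ?V" "distinct \<pi>"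
      using bij' \<open>set \<tau> = verts G\<close> \<open>distinct \<tau>\<close> by (auto simp: \<pi>_def distinct_map bij_betw_def)
    ultimately show "\<exists>\<pi>. \<tau> = map ?h \<pi> \<and> feasible \<pi> \<and> set \<pi> = ?V" using main \<tau> by blast
  next
    assume "\<exists>\<pi>. \<tau> = map ?h \<pi> \<and> feasible \<pi> \<and> set \<pi> = ?V"
    then show "\<tau> \<in> or_feasible G" using main by (auto simp: feasible_def)
  qed
qed

section \<open>The approximation guarantee and the polynomial bound\<close>

lemma greedy_program_approximates:
  assumes G: "inforest G"
    and f: "mono_on (Pow (verts G)) f" "f {} = 0" "modular_on (verts G) f"
    and g: "mono_on (Pow (verts G)) g" "g {} = 0" "submodular_on (verts G) g"
  shows "approximates_within 4 greedy_program (program_time (card (verts G))) G f g"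
  unfolding approximates_within_def
proof
  fix vs assume vs: "vs \<in> permutations_of_set (verts G)"
  define I where "I = present vs G f g"
  interpret or_machine I
    unfolding I_def by (rule or_machine_present) fact+
  have wf: "wf_digraph G" using G by (auto simp: inforest_def dag_def digraph_def fin_digraph_def)
  note feasible_iff = or_feasible_iff[OF I_def vs wf]
  have n: "num_vertices I = length vs" by (simp add: I_def present_def)
  have len: "card (verts G) = length vs"
    using vs by (auto simp: permutations_of_set_def dest: distinct_card)
  have cost: "ordering_cost f g (map ((!) vs) \<pi>) = ordering_cost (f_oracle I) (g_oracle I) \<pi>" for \<pi>
    by (simp add: ordering_cost_map I_def present_def)
  obtain t s \<pi> where run: "exec I greedy_program init t s" "t \<le> program_time (num_vertices I)"
    and \<pi>: "greedy \<pi>" "set \<pi> = {..<num_vertices I}" "\<forall>j<num_vertices I. nat_mem s ''out'' j = \<pi> ! j"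
    using runs_greedy_program unfolding runs_def by blast
  let ?\<sigma> = "map ((!) vs) \<pi>"
  have feas: "feasible \<pi>" using \<pi>(1) by (rule greedy_feasible)
  then have length: "length \<pi> = length vs"
    using \<pi>(2) by (metis card_lessThan distinct_card feasible_def n)
  have \<sigma>: "?\<sigma> \<in> or_feasible G" unfolding feasible_iff using feas \<pi>(2) n by auto
  have "outputs vs s ?\<sigma>"
    using \<pi>(2,3) length n by (auto simp: outputs_def)
  \<comment> \<open>With the factor moved to the left, the claim is a lower bound on a minimum and
    can be checked for each feasible order separately; \<open>?\<sigma>\<close> shows that there is
    one.\<close>
  moreover have "ordering_cost f g ?\<sigma> / 4 \<le> Min (ordering_cost f g ` or_feasible G)"
  proof (rule Min.boundedI)
    have "or_feasible G \<subseteq> permutations_of_set (verts G)" by (auto simp: or_feasible_def)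
    then show "finite (ordering_cost f g ` or_feasible G)"
      by (meson finite_imageI finite_permutations_of_set finite_subset)
    fix x assume "x \<in> ordering_cost f g ` or_feasible G"
    then obtain \<upsilon> where \<upsilon>: "x = ordering_cost f g \<upsilon>" "\<upsilon> \<in> or_feasible G" by (rule imageE)
    from \<upsilon>(2)[unfolded feasible_iff]
    obtain \<tau> where "feasible \<tau>" "set \<tau> = {..<length vs}" "x = ordering_cost f g (map ((!) vs) \<tau>)"
      using \<upsilon>(1) by (elim exE conjE) simp
    then show "ordering_cost f g ?\<sigma> / 4 \<le> x"
      using greedy_approximation[OF \<pi>(1,2), of \<tau>] by (simp add: cost n)
  qed (use \<sigma> in auto)
  ultimately show "\<exists>t s \<sigma>. exec (present vs G f g) greedy_program init t s \<and>
      t \<le> program_time (card (verts G)) \<and> outputs vs s \<sigma> \<and> \<sigma> \<in> or_feasible G \<and>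
      ordering_cost f g \<sigma> \<le> 4 * Min (ordering_cost f g ` or_feasible G)"
    using run \<sigma> n len unfolding I_def
    by (intro exI[of _ t] exI[of _ s] exI[of _ ?\<sigma>]) auto
qed

lemma program_time_poly: "\<exists>p :: nat poly. \<forall>n. program_time n = poly p n"
proof
  \<comment> \<open>\<open>[:0, 1:]\<close> is the indeterminate and \<open>?w\<close> the
    polynomial of \<open>walk_time\<close>.\<close>
  let ?w = "[:12, 9:] * [:0, 1:] + 1 :: nat poly"
  show "\<forall>n. program_time n =
      poly ((([:12, 14:] + ?w + 2) * [:0, 1:] + 2 + [:3, 4:] + 1) * [:0, 1:] + 1) n"
    by (simp add: program_time_def round_time_def start_time_def walk_time_def algebra_simps)
qed

theorem theorem2:
  shows "\<exists>(c :: com) (p :: nat poly).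
    \<forall>(G :: ('a, 'b) pre_digraph) (f :: 'a set \<Rightarrow> real) (g :: 'a set \<Rightarrow> real).
      inforest G \<and>
      mono_on (Pow (verts G)) f \<and> mono_on (Pow (verts G)) g \<and> f {} = 0 \<and> g {} = 0 \<and>
      modular_on (verts G) f \<and> submodular_on (verts G) g \<longrightarrow>
      approximates_within 4 c (poly p (card (verts G))) G f g"
proof -
  from program_time_poly obtain p :: "nat poly" where "\<And>n. program_time n = poly p n" by blast
  then show ?thesis
    using greedy_program_approximates
    by (intro exI[of _ greedy_program] exI[of _ p] allI impI) (elim conjE, simp)
qed

end
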